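(* Let $q$ be a prime power of the form $q=12c^2+4c+3$ for some integer $c$, and let $n=q^2$. Then there exists a difference family with parameters $(2n;n,n,n,n-1;2n-2)$ in the group $\mathbb{Z}_2\times(\mathbb{F}_{q^2},+)$.
   Context: Let $(G,+)$ be a finite abelian group. For subsets $B_1,\dots,B_\ell\subseteq G$ with $|B_i|=k_i$, the collection $\{B_1,\dots,B_\ell\}$ is a difference family with parameters $(v;k_1,\dots,k_\ell;\lambda)$ in $G$ (where $v=|G|$) if the multiset of differences $x-y$ with $x,y\in B_i$, $x\neq y$, $i=1,\dots,\ell$, contains every nonzero element of $G$ exactly $\lambda$ times. *)

theory Defs
  imports Main "HOL-Library.Z2" "HOL-Library.Product_Plus" "HOL-Computational_Algebra.Primes"
begin

definition diff_count :: "'g::ab_group_add set list \<Rightarrow> 'g \<Rightarrow> nat" where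
  "diff_count Bs g =
     (\<Sum>i<length Bs. card {(x, y). x \<in> Bs ! i \<and> y \<in> Bs ! i \<and> x \<noteq> y \<and> x - y = g})"

definition difference_family :: "'g::ab_group_add set list \<Rightarrow> nat \<Rightarrow> bool" where
  "difference_family Bs lam \<longleftrightarrow>
     (\<forall>i<length Bs. finite (Bs ! i)) \<and> (\<forall>g. g \<noteq> 0 \<longrightarrow> diff_count Bs g = lam)"

definition prime_power :: "nat \<Rightarrow> bool" where
  "prime_power q \<longleftrightarrow> (\<exists>p k. prime p \<and> k \<ge> 1 \<and> q = p ^ k)"

end

theory Submission
  imports Defs "HOL-Number_Theory.Residues"
begin

text \<open>
  A block of \<open>\<int>\<^sub>2 \<times> F\<close>, with \<open>F\<close> the field of order \<open>q\<^sup>2\<close>, is a pair of \<open>\<plusminus>1\<close>-valued functions on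
  \<open>F\<close>, and being a difference family is a condition on the sums of their autocorrelations and of
  their cross-correlations. These sums are determined by their sums over the affine lines
  \<open>tr (d y) = t\<close> over the subfield \<open>K\<close> of order \<open>q\<close> (Radon inversion). If a function is, away from 0,
  the sum of one that is constant on the punctured lines through 0 and one that scalars from \<open>K\<close>
  multiply by their quadratic character \<open>eta\<close>, then its line sums are
  \<open>r [t = 0] + m + T eta t\<close>, and only \<open>r\<close> and \<open>T\<close> enter the correlation conditions.

  Since \<open>q\<close> is 3 modulo 8, the octic classes of \<open>F\<close> behave in this way, and their values \<open>T\<close> are
  integral combinations of \<open>tau 0\<close> and \<open>tau 1\<close> with \<open>(tau 0)\<^sup>2 + 2 (tau 1)\<^sup>2 = q\<close> (essentially a Gauss
  sum of order 8, lying in \<open>\<int>[\<surd>-2]\<close>). Here \<open>tau 0\<close> is prime to the characteristic, so that this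
  representation is unique up to signs. The hypothesis says
  \<open>q = (2 c - 1)\<^sup>2 + 2 (2 c + 1)\<^sup>2\<close>, hence \<open>tau 0 \<plusminus> tau 1 = \<plusminus>2\<close> for one choice of the sign. Each
  function of the first two blocks is signed on three of the four pairs of opposite octic classes
  and constant on the lines in the fourth; the cross-correlations of these blocks involve
  \<open>(tau 0 \<plusminus> tau 1)\<^sup>2 = 4\<close>, which is exactly what two blocks of Paley type compensate.
\<close>

subsection \<open>Arithmetic preliminaries\<close>

text \<open>The type-class field is recast as a record over \<open>UNIV\<close>, to which the
  theorem on cyclic unit groups of finite fields applies.\<close>

lemma finite_field_generator:
  "\<exists>g::'a::{finite,field}. \<forall>y. y \<noteq> 0 \<longrightarrow> (\<exists>i::nat. y = g ^ i)"
proof -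
  define R :: "'a ring" where
    "R = \<lparr>carrier = UNIV, monoid.mult = (*), one = 1, ring.zero = 0, add = (+)\<rparr>"
  have "\<exists>y. x + y = 0" for x :: 'a
    using add.right_inverse by blast
  moreover have "x \<noteq> 0 \<Longrightarrow> \<exists>y. x * y = 1" for x :: 'a
    by (rule exI[of _ "inverse x"]) auto
  ultimately interpret R: field R
    unfolding R_def by unfold_locales (auto simp: algebra_simps Units_def)
  have car: "carrier (mult_of R) = UNIV - {0}"
    by (simp add: R_def)
  have pow: "a [^]\<^bsub>R\<^esub> i = a ^ i" for a :: 'a and i :: nat
    by (induction i) (simp_all add: R_def nat_pow_def mult.commute)
  have "finite (carrier R)" by simp
  from R.finite_field_mult_group_has_gen[OF this] obtain a where
    "carrier (mult_of R) = {a [^]\<^bsub>R\<^esub> i | i::nat. i \<in> UNIV}"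
    by auto
  then show ?thesis unfolding car pow by blast
qed

section \<open>Binomial coefficients and their prime divisors\<close>

text \<open>Legendre's formula, one digit at a time: the multiples of \<open>p\<close> up to
  \<open>p * n\<close> contribute \<open>n\<close> factors \<open>p\<close> together with the
  valuation of \<open>fact n\<close>; all other factors are prime to \<open>p\<close>.\<close>

lemma multiplicity_fact_add:
  fixes p :: nat
  assumes "prime p" "a < p"
  shows "multiplicity p (fact (p * n + a) :: nat) = n + multiplicity p (fact n :: nat)"
  using assms(2)
proof (induction n arbitrary: a)
  case 0
  then have "\<not> p dvd fact a" using assms(1) by (simp add: prime_dvd_fact_iff)
  then show ?case by (simp add: not_dvd_imp_multiplicity_0)
next
  case (Suc n)
  have step: "multiplicity p (fact (p * Suc n) :: nat) = Suc n + multiplicity p (fact (Suc n) :: nat)"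
  proof -
    have p0: "p > 0" using assms(1) prime_gt_0_nat by blast
    \<comment> \<open>Peeling off the multiple \<open>p * Suc n\<close> leaves a factorial whose
      last base-\<open>p\<close> digit is the largest one, \<open>p - 1\<close>.\<close>
    have "fact (p * Suc n) = (p * Suc n) * (fact (p * n + (p - 1)) :: nat)"
      using p0 by (subst fact_reduce) (auto simp: algebra_simps)
    then have "multiplicity p (fact (p * Suc n) :: nat) =
        multiplicity p (p * Suc n) + multiplicity p (fact (p * n + (p - 1)) :: nat)"
      using p0 by (simp only:) (subst prime_elem_multiplicity_mult_distrib, use assms(1) in auto)
    also have "multiplicity p (p * Suc n) = Suc (multiplicity p (Suc n))"
      by (rule multiplicity_times_same)
        (use p0 prime_gt_1_nat[OF assms(1)] in simp_all)
    also have "multiplicity p (fact (p * n + (p - 1)) :: nat) = n + multiplicity p (fact n :: nat)"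
      using Suc.IH[of "p - 1"] p0 by simp
    also have "Suc (multiplicity p (Suc n)) + (n + multiplicity p (fact n :: nat)) =
        Suc n + multiplicity p (fact (Suc n) :: nat)"
      unfolding fact_Suc of_nat_id
      by (subst prime_elem_multiplicity_mult_distrib) (use assms(1) in auto)
    finally show ?thesis .
  qed
  show ?case using Suc.prems
  proof (induction a)
    case 0 then show ?case using step by simp
  next
    case (Suc a)
    have "\<not> p dvd (p * Suc n + Suc a)"
      using Suc.prems by (metis dvd_add_right_iff dvd_triv_left nat_dvd_not_less zero_less_Suc)
    then have "multiplicity p (p * Suc n + Suc a) = 0" by (rule not_dvd_imp_multiplicity_0)
    moreover have "fact (p * Suc n + Suc a) = (p * Suc n + Suc a) * (fact (p * Suc n + a) :: nat)"
      by (simp add: algebra_simps)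
    ultimately show ?case using Suc assms(1)
      by (simp only:) (subst prime_elem_multiplicity_mult_distrib, auto)
  qed
qed

text \<open>Adding a lowest base-\<open>p\<close> digit without creating a carry does not change the
  \<open>p\<close>-adic valuation of a binomial coefficient.\<close>

lemma prime_dvd_binomial_add_digit:
  fixes p :: nat
  assumes "prime p" "a < p" "b \<le> a" "m \<le> n"
  shows "p dvd ((p * n + a) choose (p * m + b)) \<longleftrightarrow> p dvd (n choose m)"
proof -
  have fb: "multiplicity p (fact n :: nat) =
      multiplicity p (fact m :: nat) + multiplicity p (fact (n - m) :: nat) + multiplicity p (n choose m)"
    if "m \<le> n" for n m
  proof -
    have "fact n = (fact m * fact (n - m)) * (n choose m :: nat)"
      using binomial_fact_lemma[OF that] by simp
    then show ?thesis using assms(1) that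
      by (simp add: prime_elem_multiplicity_mult_distrib)
  qed
  have d: "p * n + a - (p * m + b) = p * (n - m) + (a - b)"
    using assms by (simp add: diff_mult_distrib2)
  have le: "p * m + b \<le> p * n + a" using assms by (simp add: add_mono)
  have "multiplicity p ((p * n + a) choose (p * m + b)) = multiplicity p (n choose m)"
    using fb[OF le] fb[OF assms(4)] assms
      multiplicity_fact_add[OF assms(1,2), of n] multiplicity_fact_add[OF assms(1), of b m]
      multiplicity_fact_add[OF assms(1), of "a - b" "n - m"] unfolding d by simp
  moreover have "p dvd x \<longleftrightarrow> multiplicity p x \<noteq> 0" if "x \<noteq> 0" for x
    using that assms(1) by (metis multiplicity_eq_zero_iff not_prime_unit)
  ultimately show ?thesis using le assms(4) by (metis binomial_eq_0_iff not_le)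
qed

text \<open>With \<open>p = 8 * s + 3\<close>, every base-\<open>p\<close> digit of the upper entry
  is \<open>4 * s + 1\<close>, while the digits of the lower entry alternate between
  \<open>s\<close> and \<open>3 * s + 1\<close>. No digit exceeds the one above it, so the induction
  can remove two digits at a time.\<close>

lemma not_prime_dvd_octic_binomial:
  fixes p :: nat
  assumes "prime p" "p mod 8 = 3"
  shows "\<not> p dvd ((p ^ (2 * j + 1) - 1) div 2 choose ((p ^ (2 * j + 1) - 3) div 8))"
proof (induction j)
  case 0
  have "\<not> p dvd ((p * 0 + (p - 1) div 2) choose (p * 0 + (p - 3) div 8))"
    using assms prime_gt_0_nat[OF assms(1)]
    by (subst prime_dvd_binomial_add_digit) (auto simp: prime_nat_iff)
  then show ?case by simp
next
  case (Suc j)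
  define P where "P = p ^ (2 * j + 1)"
  obtain s where s: "p = 8 * s + 3" using assms(2) by (metis mult_div_mod_eq)
  have "P mod 8 = 3"
  proof -
    have "P = p * (p\<^sup>2) ^ j" by (simp add: P_def power_mult)
    moreover have "[p\<^sup>2 = 3\<^sup>2] (mod 8)" using assms(2) by (intro cong_pow) (simp add: cong_def)
    then have "[p\<^sup>2 = 1] (mod 8)" by (simp add: cong_def)
    then have "[(p\<^sup>2) ^ j = 1 ^ j] (mod 8)" by (rule cong_pow)
    then have "[p * (p\<^sup>2) ^ j = p * 1] (mod 8)" using cong_scalar_left by fastforce
    ultimately show ?thesis using assms(2) by (simp add: cong_def)
  qed
  then obtain r where r: "P = 8 * r + 3" by (metis mult_div_mod_eq)
  have P2: "p ^ (2 * Suc j + 1) = p * (p * P)" by (simp add: P_def)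
  have "p * (p * P) = 2 * (p * (p * (4 * r + 1) + (4 * s + 1)) + (4 * s + 1)) + 1"
    unfolding r s by (simp add: algebra_simps)
  then have h1: "(p * (p * P) - 1) div 2 = p * (p * (4 * r + 1) + (4 * s + 1)) + (4 * s + 1)"
    by simp
  have "p * (p * P) = 8 * (p * (p * r + (3 * s + 1)) + s) + 3"
    unfolding r s by (simp add: algebra_simps)
  then have h2: "(p * (p * P) - 3) div 8 = p * (p * r + (3 * s + 1)) + s"
    by simp
  have ih: "\<not> p dvd ((4 * r + 1) choose r)" using Suc unfolding P_def[symmetric] r by simp
  have le: "p * r + (3 * s + 1) \<le> p * (4 * r + 1) + (4 * s + 1)" by (simp add: add_mono)
  have "p dvd ((p * (p * (4 * r + 1) + (4 * s + 1)) + (4 * s + 1)) choose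
          (p * (p * r + (3 * s + 1)) + s)) \<longleftrightarrow>
        p dvd ((p * (4 * r + 1) + (4 * s + 1)) choose (p * r + (3 * s + 1)))"
    using le by (intro prime_dvd_binomial_add_digit assms(1)) (auto simp: s)
  also have "\<dots> \<longleftrightarrow> p dvd ((4 * r + 1) choose r)"
    by (intro prime_dvd_binomial_add_digit assms(1)) (auto simp: s)
  finally show ?case unfolding P2 h1 h2 using ih by simp
qed

section \<open>Uniqueness of representations by \<open>x^2 + 2 * y^2\<close>\<close>

text \<open>As \<open>p\<close> divides at most one of \<open>a * v - b * u\<close> and
  \<open>a * v + b * u\<close>, the whole power \<open>p ^ k\<close> divides one of them. Composing
  the two representations gives one of the square of \<open>p ^ k\<close> whose second entry is that
  number, and its size forces it to be 0.\<close>

lemma square_plus_two_squares_unique: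
  fixes a b u v :: int and p :: nat
  assumes "prime p" "p \<noteq> 2"
    and ab: "a\<^sup>2 + 2 * b\<^sup>2 = int (p ^ k)" and uv: "u\<^sup>2 + 2 * v\<^sup>2 = int (p ^ k)"
    and "k \<ge> 1" and na: "\<not> int p dvd a" and nu: "\<not> int p dvd u"
  shows "u\<^sup>2 = a\<^sup>2 \<and> v\<^sup>2 = b\<^sup>2"
proof -
  define Q where "Q = int (p ^ k)"
  have pr: "prime (int p)" using assms(1) by simp
  have Qpos: "Q > 0" unfolding Q_def using assms(1) prime_gt_0_nat by simp
  have prod: "(a * v - b * u) * (a * v + b * u) = Q * (v\<^sup>2 - b\<^sup>2)"
  proof -
    have a2: "a\<^sup>2 = Q - 2 * b\<^sup>2" and u2: "u\<^sup>2 = Q - 2 * v\<^sup>2"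
      using ab uv unfolding Q_def by simp_all
    have "(a * v - b * u) * (a * v + b * u) = a\<^sup>2 * v\<^sup>2 - b\<^sup>2 * u\<^sup>2"
      by (simp add: algebra_simps power2_eq_square)
    then show ?thesis unfolding a2 u2 by (simp add: algebra_simps)
  qed
  have "int p dvd Q" unfolding Q_def using \<open>k \<ge> 1\<close> by (simp add: dvd_power)
  have nv: "\<not> int p dvd v"
  proof
    assume "int p dvd v"
    then have "int p dvd Q - 2 * v\<^sup>2" using \<open>int p dvd Q\<close> by (simp add: power2_eq_square)
    then have "int p dvd u\<^sup>2" using uv unfolding Q_def by (metis add_diff_cancel_right')
    then show False using nu pr prime_dvd_power by blast
  qed
  have odd: "\<not> int p dvd 2" using assms(1,2)
    by (metis int_dvd_int_iff of_nat_numeral primes_dvd_imp_eq two_is_prime_nat)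
  have "\<not> (int p dvd a * v - b * u \<and> int p dvd a * v + b * u)"
  proof
    assume "int p dvd a * v - b * u \<and> int p dvd a * v + b * u"
    then have "int p dvd (a * v - b * u) + (a * v + b * u)" using dvd_add by blast
    then have "int p dvd 2 * (a * v)" by (simp add: algebra_simps)
    then show False using odd na nv pr by (simp add: prime_dvd_mult_iff)
  qed
  moreover have "Q dvd (a * v - b * u) * (a * v + b * u)" unfolding prod by simp
  ultimately have disj: "Q dvd a * v - b * u \<or> Q dvd a * v + b * u"
    unfolding Q_def of_nat_power
    by (metis coprime_commute coprime_dvd_mult_left_iff coprime_dvd_mult_right_iff coprime_power_left_iff pr prime_imp_coprime)
  have zero: "w = 0" if "Q dvd w" "x\<^sup>2 + 2 * w\<^sup>2 = Q\<^sup>2" for w x :: int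
  proof (rule ccontr)
    assume "w \<noteq> 0"
    then have "Q \<le> \<bar>w\<bar>" using that(1) dvd_imp_le_int[of w Q] Qpos by simp
    then have "Q\<^sup>2 \<le> w\<^sup>2" using Qpos by (metis abs_le_square_iff abs_of_pos)
    moreover have "x\<^sup>2 \<ge> 0" "Q\<^sup>2 > 0" using Qpos by auto
    ultimately show False using that(2) by linarith
  qed
  \<comment> \<open>Brahmagupta's identity for norms from Z[sqrt(-2)], with either sign of
    \<open>b\<close>.\<close>
  have e1: "(a * u + 2 * b * v)\<^sup>2 + 2 * (a * v - b * u)\<^sup>2 = Q\<^sup>2"
    and e2: "(a * u - 2 * b * v)\<^sup>2 + 2 * (a * v + b * u)\<^sup>2 = Q\<^sup>2"
    unfolding Q_def power2_eq_square[of "int (p ^ k)"]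
    by (subst (1) ab[symmetric], subst uv[symmetric], simp add: algebra_simps power2_eq_square)+
  have "(a * v - b * u) * (a * v + b * u) = 0" using disj zero e1 e2 by fastforce
  then have "v\<^sup>2 = b\<^sup>2" using prod Qpos by simp
  then show ?thesis using ab uv by simp
qed

lemma odd_square_mod_8: "odd (n::nat) \<Longrightarrow> n\<^sup>2 mod 8 = 1"
proof -
  assume "odd n"
  then obtain t where "n = 2 * t + 1" by (rule oddE)
  then have "n\<^sup>2 = 4 * (t * (t + 1)) + 1" by (simp add: power2_eq_square algebra_simps)
  moreover obtain w where "t * (t + 1) = 2 * w" by (metis dvdE even_mult_iff odd_even_add odd_one)
  ultimately have "n\<^sup>2 = 8 * w + 1" by simp
  then show ?thesis by simp
qed

section \<open>Sums over residues\<close>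

lemma sum_lessThan_4: "(\<Sum>k<4. f k) = f 0 + f 1 + f 2 + f (3::nat)"
  by (simp add: eval_nat_numeral)

lemma sum_lessThan_8:
  "(\<Sum>k<8. f k) = f 0 + f 1 + f 2 + f 3 + f 4 + f 5 + f 6 + (f (7::nat) :: int)"
  by (simp add: eval_nat_numeral)

lemma sum_mod_period: "(\<Sum>i<a * b. f (i mod b)) = int a * (\<Sum>v<b. f v)" for f :: "nat \<Rightarrow> int"
proof -
  have "(\<Sum>i<a * b. f (i mod b)) = (\<Sum>k<a. \<Sum>i = k * b..<k * b + b. f (i mod b))"
    by (rule sum.nat_group[symmetric])
  also have "\<dots> = (\<Sum>k<a. \<Sum>v<b. f v)"
  proof (rule sum.cong[OF refl])
    fix k
    show "(\<Sum>i = k * b..<k * b + b. f (i mod b)) = (\<Sum>v<b. f v)"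
    proof (rule sum.reindex_bij_witness[of _ "\<lambda>v. k * b + v" "\<lambda>i. i - k * b"])
      fix i assume i: "i \<in> {k * b..<k * b + b}"
      then have "i = k * b + (i - k * b)" "i - k * b < b" by auto
      then have "i mod b = i - k * b" by (metis mod_less mod_mult_self3)
      then show "f (i - k * b) = f (i mod b)" by simp
    qed auto
  qed
  finally show ?thesis by simp
qed

lemma mod_8_cases: "x mod 8 \<in> {0, 1, 2, 3, 4, 5, 6, 7}" for x :: int
  by auto

lemma less_8_cases: "i < 8 \<Longrightarrow> i \<in> {0, 1, 2, 3, 4, 5, 6, 7}" for i :: nat
  by auto

subsection \<open>The field of order \<open>q\<^sup>2\<close> over its subfield of order \<open>q\<close>\<close>

text \<open>The coefficient of 1 in \<open>w ^ k\<close> over the basis 1, \<open>w\<close>,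
  \<open>w ^ 2\<close>, \<open>w ^ 3\<close> when \<open>w ^ 4 = -1\<close>; compare
  \<open>power_eq_sum_oct_sgn\<close>.\<close>

definition oct_sgn :: "int \<Rightarrow> int" where
  "oct_sgn k = (if k mod 8 = 0 then 1 else if k mod 8 = 4 then -1 else 0)"

lemma oct_sgn_cong: "k mod 8 = l mod 8 \<Longrightarrow> oct_sgn k = oct_sgn l"
  by (simp add: oct_sgn_def)

lemma oct_sgn_add_4: "oct_sgn (k + 4) = - oct_sgn k"
proof -
  have "(k + 4) mod 8 = 0 \<longleftrightarrow> k mod 8 = 4" "(k + 4) mod 8 = 4 \<longleftrightarrow> k mod 8 = 0"
    by presburger+
  then show ?thesis unfolding oct_sgn_def by simp
qed

lemma oct_sgn_add_mult_4: "k mod 4 = 0 \<Longrightarrow> oct_sgn (k + l) = oct_sgn k * oct_sgn l"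
proof -
  assume "k mod 4 = 0"
  then have "k mod 8 = 0 \<or> k mod 8 = 4" by presburger
  then consider "k mod 8 = 0" | "k mod 8 = 4" by blast
  then show ?thesis
  proof cases
    case 1
    then have "oct_sgn (k + l) = oct_sgn l"
      by (intro oct_sgn_cong) (metis add_0 mod_add_left_eq)
    with 1 show ?thesis by (simp add: oct_sgn_def[of k])
  next
    case 2
    then have "oct_sgn (k + l) = oct_sgn (l + 4)"
      by (intro oct_sgn_cong) (metis add.commute mod_add_left_eq)
    with 2 show ?thesis by (simp add: oct_sgn_add_4 oct_sgn_def[of k])
  qed
qed

text \<open>The additive \<open>q\<close>-th power map is the automorphism whose fixed field is the
  subfield of order \<open>q\<close>. The prime below \<open>q\<close> enters only with
  \<open>tau 0\<close>.\<close>

locale quadratic_extension =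
  fixes q :: nat and g :: "'a::{finite,field}"
  assumes card_field: "card (UNIV :: 'a set) = q\<^sup>2"
    and q_mod_8: "q mod 8 = 3"
    and frobenius_add: "\<And>x y :: 'a. (x + y) ^ q = x ^ q + y ^ q"
    and generator: "\<And>y. y \<noteq> 0 \<Longrightarrow> \<exists>i. y = g ^ i"
begin

definition N :: nat where "N = q\<^sup>2 - 1"

lemma q_ge_3: "q \<ge> 3" using q_mod_8 by (metis mod_less_eq_dividend)

lemma q_odd: "odd q" using q_mod_8 by presburger

lemma N_pos: "N > 0"
proof -
  have "3 * 3 \<le> q\<^sup>2" unfolding power2_eq_square using q_ge_3 by (intro mult_le_mono)
  then show ?thesis by (simp add: N_def)
qed

lemma N_eq: "N = (q - 1) * (q + 1)"
  by (simp add: N_def power2_eq_square algebra_simps)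

lemma eight_dvd_N: "8 dvd N"
proof -
  obtain s where s: "q = 8 * s + 3" using q_mod_8 by (metis mult_div_mod_eq)
  have "N = 8 * (8 * s\<^sup>2 + 6 * s + 1)" unfolding N_def unfolding s by (simp add: power2_eq_square algebra_simps)
  then show ?thesis by simp
qed

lemma card_units: "card (UNIV - {0::'a}) = N"
  using card_field by (simp add: N_def card_Diff_singleton)

lemma g_nonzero: "g \<noteq> 0"
proof
  assume "g = 0"
  have "y \<in> {0, 1}" for y :: 'a
    using generator[of y] \<open>g = 0\<close> by (metis insertCI power_0_left)
  then have "card (UNIV :: 'a set) \<le> card {0, 1::'a}" by (intro card_mono) auto
  then have "q\<^sup>2 \<le> 2" using card_field by simp
  moreover have "3 * 3 \<le> q\<^sup>2" unfolding power2_eq_square using q_ge_3 by (intro mult_le_mono)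
  ultimately show False by simp
qed

lemma power_N: assumes "x \<noteq> (0::'a)" shows "x ^ N = 1"
proof -
  let ?U = "UNIV - {0::'a}"
  have "(\<Prod>y\<in>?U. x * y) = (\<Prod>y\<in>?U. y)"
    by (rule prod.reindex_bij_witness[of _ "\<lambda>y. y / x" "\<lambda>y. x * y"]) (use assms in auto)
  moreover have "(\<Prod>y\<in>?U. x * y) = x ^ N * (\<Prod>y\<in>?U. y)"
    by (simp only: prod.distrib prod_constant card_units)
  moreover have "(\<Prod>y\<in>?U. y) \<noteq> 0" by simp
  ultimately show ?thesis by simp
qed

lemma g_power_mod: "g ^ (i mod N) = g ^ i"
proof -
  have "g ^ i = g ^ (N * (i div N) + i mod N)" by simp
  also have "\<dots> = (g ^ N) ^ (i div N) * g ^ (i mod N)" by (simp only: power_add power_mult)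
  also have "\<dots> = g ^ (i mod N)" using power_N[OF g_nonzero] by simp
  finally show ?thesis by simp
qed

lemma bij_g_power: "bij_betw (\<lambda>i. g ^ i) {..<N} (UNIV - {0})"
proof -
  have img: "(\<lambda>i. g ^ i) ` {..<N} = UNIV - {0}"
  proof (intro equalityI subsetI)
    fix y assume "y \<in> UNIV - {0::'a}"
    then obtain i where "y = g ^ i" using generator by auto
    then have "y = g ^ (i mod N)" using g_power_mod by simp
    then show "y \<in> (\<lambda>i. g ^ i) ` {..<N}" using N_pos by auto
  qed (use g_nonzero in auto)
  moreover have "inj_on (\<lambda>i. g ^ i) {..<N}"
    using img card_units by (intro eq_card_imp_inj_on) auto
  ultimately show ?thesis by (simp add: bij_betw_def)
qed

section \<open>Discrete logarithms\<close>

definition lg :: "'a \<Rightarrow> nat" where "lg = the_inv_into {..<N} (\<lambda>i. g ^ i)"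

lemma lg_less: "y \<noteq> 0 \<Longrightarrow> lg y < N"
  using bij_betw_the_inv_into[OF bij_g_power] unfolding lg_def bij_betw_def by blast

lemma g_power_lg: "y \<noteq> 0 \<Longrightarrow> g ^ lg y = y"
  using f_the_inv_into_f_bij_betw[OF bij_g_power] unfolding lg_def by blast

lemma lg_g_power: "lg (g ^ i) = i mod N"
  using the_inv_into_f_f[of "\<lambda>i. g ^ i" "{..<N}" "i mod N"] bij_g_power N_pos
  unfolding lg_def bij_betw_def by (simp add: g_power_mod)

lemma lg_mult: "x \<noteq> 0 \<Longrightarrow> y \<noteq> 0 \<Longrightarrow> lg (x * y) = (lg x + lg y) mod N"
  by (metis lg_g_power g_power_lg power_add)

lemma lg_power: "x \<noteq> 0 \<Longrightarrow> lg (x ^ k) = (k * lg x) mod N"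
  by (metis lg_g_power g_power_lg power_mult mult.commute)

lemma lg_1: "lg 1 = 0"
  using lg_g_power[of 0] by simp

lemma bij_lg: "bij_betw lg (UNIV - {0}) {..<N}"
  unfolding lg_def by (rule bij_betw_the_inv_into[OF bij_g_power])

lemma sum_lg: "(\<Sum>y\<in>UNIV - {0}. f (lg y)) = (\<Sum>i<N. f i)"
  by (rule sum.reindex_bij_betw[OF bij_lg])

text \<open>An integer version of the logarithm, because octic classes are shifted by
  subtraction.\<close>

definition ind :: "'a \<Rightarrow> int" where "ind y = int (lg y)"

lemma ind_mult:
  assumes "x \<noteq> 0" "y \<noteq> 0" "d dvd N"
  shows "ind (x * y) mod int d = (ind x + ind y) mod int d"
  using assms by (simp add: ind_def lg_mult mod_mod_cancel flip: of_nat_add of_nat_mod)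

lemma ind_power:
  assumes "x \<noteq> 0" "d dvd N"
  shows "ind (x ^ k) mod int d = (int k * ind x) mod int d"
  using assms by (simp add: ind_def lg_power mod_mod_cancel flip: of_nat_mult of_nat_mod)

lemma ind_mult_8: "x \<noteq> 0 \<Longrightarrow> y \<noteq> 0 \<Longrightarrow> ind (x * y) mod 8 = (ind x + ind y) mod 8"
  using ind_mult[OF _ _ eight_dvd_N] by simp

lemma frobenius_diff: "(x - y :: 'a) ^ q = x ^ q - y ^ q"
  using frobenius_add[of "x - y" y] by (simp add: algebra_simps)

lemma frobenius_minus: "(- x :: 'a) ^ q = - (x ^ q)"
  using q_odd by simp

lemma frobenius_frobenius: "((x::'a) ^ q) ^ q = x"
proof (cases "x = 0")
  case False
  have "(x ^ q) ^ q = x ^ (N + 1)" using q_ge_3 by (simp add: N_def power_mult[symmetric] power2_eq_square)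
  then show ?thesis using power_N[OF False] by (simp only: power_add) simp
qed (use q_ge_3 in simp)

text \<open>In characteristic 2 the only square root of 1 is 1, but \<open>g ^ (N div 2)\<close>
  would be a second one.\<close>

lemma two_nonzero: "(2::'a) \<noteq> 0"
proof
  assume two: "(2::'a) = 0"
  have "g ^ (N div 2) * g ^ (N div 2) = g ^ N"
    using eight_dvd_N by (simp only: power_add[symmetric]) (metis dvd_mult_div_cancel dvd_trans even_numeral mult_2)
  then have "(g ^ (N div 2) - 1) * (g ^ (N div 2) + 1) = 0"
    using power_N[OF g_nonzero] by (simp add: algebra_simps)
  moreover have "(1::'a) = - 1" using two by (metis add_eq_0_iff one_add_one)
  ultimately have "g ^ (N div 2) = g ^ 0" by (metis add_uminus_conv_diff add.right_inverse eq_iff_diff_eq_0 mult_eq_0_iff power_0)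
  then have "(N div 2) mod N = 0" by (metis lg_g_power mod_0)
  then show False using eight_dvd_N N_pos by (metis dvd_div_eq_0_iff div_less_dividend dvd_trans even_numeral mod_less not_less_zero one_less_numeral_iff semiring_norm(76) neq0_conv)
qed

section \<open>The subfield of order \<open>q\<close> and its quadratic character\<close>

definition K :: "'a set" where "K = {x. x ^ q = x}"

lemma K_simps: "0 \<in> K" "1 \<in> K"
  "x \<in> K \<Longrightarrow> y \<in> K \<Longrightarrow> x + y \<in> K" "x \<in> K \<Longrightarrow> y \<in> K \<Longrightarrow> x - y \<in> K"
  "x \<in> K \<Longrightarrow> y \<in> K \<Longrightarrow> x * y \<in> K" "x \<in> K \<Longrightarrow> y \<in> K \<Longrightarrow> x / y \<in> K" "x \<in> K \<Longrightarrow> - x \<in> K"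
  using q_ge_3 by (auto simp: K_def frobenius_add frobenius_diff frobenius_minus power_mult_distrib power_divide)

text \<open>A unit is in \<open>K\<close> when its power with exponent \<open>q - 1\<close> is 1.
  Since \<open>N = (q - 1) * (q + 1)\<close>, the units of \<open>K\<close> are the powers of
  \<open>g ^ (q + 1)\<close>.\<close>

lemma K_iff_lg: assumes "x \<noteq> 0" shows "x \<in> K \<longleftrightarrow> (q + 1) dvd lg x"
proof -
  have "x ^ q = x * x ^ (q - 1)" using q_ge_3 by (simp add: power_eq_if)
  then have "x \<in> K \<longleftrightarrow> x ^ (q - 1) = 1" using assms unfolding K_def by auto
  also have "\<dots> \<longleftrightarrow> lg (x ^ (q - 1)) = 0"
    using assms by (metis g_power_lg lg_1 power_0 power_not_zero)
  also have "\<dots> \<longleftrightarrow> N dvd (q - 1) * lg x"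
    using assms by (simp add: lg_power dvd_eq_mod_eq_0)
  also have "\<dots> \<longleftrightarrow> (q + 1) dvd lg x"
    unfolding N_eq by (rule nat_mult_dvd_cancel1) (use q_ge_3 in simp)
  finally show ?thesis .
qed

lemma sum_K_units: "(\<Sum>x\<in>K - {0}. f x) = (\<Sum>j<q - 1. f (g ^ ((q + 1) * j)))"
proof -
  have lt: "(q + 1) * j < N" if "j < q - 1" for j
    unfolding N_eq using that by (metis add_gr_0 mult.commute mult_less_mono1 zero_less_one)
  show ?thesis
  proof (rule sum.reindex_bij_witness[of _ "\<lambda>j. g ^ ((q + 1) * j)" "\<lambda>x. lg x div (q + 1)"])
    fix x assume x: "x \<in> K - {0}"
    then have d: "(q + 1) dvd lg x" using K_iff_lg by blast
    then show "g ^ ((q + 1) * (lg x div (q + 1))) = x"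
      using x g_power_lg by (simp only: dvd_mult_div_cancel) simp
    then show "f (g ^ ((q + 1) * (lg x div (q + 1)))) = f x" by simp
    have "lg x < N" using x lg_less by simp
    then show "lg x div (q + 1) \<in> {..<q - 1}"
      unfolding N_eq by (simp only: lessThan_iff less_mult_imp_div_less)
  next
    fix j assume j: "j \<in> {..<q - 1}"
    then have lgj: "lg (g ^ ((q + 1) * j)) = (q + 1) * j" using lt by (simp only: lg_g_power lessThan_iff mod_less)
    then show "lg (g ^ ((q + 1) * j)) div (q + 1) = j" by (simp only: nonzero_mult_div_cancel_left add_eq_0_iff_both_eq_0 one_neq_zero simp_thms)
    have "g ^ ((q + 1) * j) \<noteq> 0" using g_nonzero by simp
    then show "g ^ ((q + 1) * j) \<in> K - {0}" using K_iff_lg lgj by (metis Diff_iff dvd_triv_left singletonD)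
  qed
qed

lemma card_K: "card K = q"
proof -
  have "card (K - {0}) = q - 1" using sum_K_units[of "\<lambda>_. 1 :: nat"] by simp
  moreover have "card K = Suc (card (K - {0}))" using K_simps(1) by (metis card.remove finite)
  ultimately show ?thesis using q_ge_3 by simp
qed

text \<open>On \<open>K\<close> the sign of the octic index is the quadratic character, because \<open>q + 1\<close> is
  congruent to 4 modulo 8.\<close>

definition eta :: "'a \<Rightarrow> int" where "eta t = (if t = 0 then 0 else oct_sgn (ind t))"

lemma ind_K_mod_4: assumes "t \<in> K" "t \<noteq> 0" shows "ind t mod 4 = 0"
proof -
  have "4 dvd q + 1" using q_mod_8 by presburger
  then have "4 dvd lg t" using assms K_iff_lg dvd_trans by blast
  then show ?thesis unfolding ind_def by presburger
qed

lemma eta_0 [simp]: "eta 0 = 0" by (simp add: eta_def)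

lemma eta_1: "eta 1 = 1" by (simp add: eta_def ind_def lg_1 oct_sgn_def)

lemma eta_square: "t \<in> K \<Longrightarrow> t \<noteq> 0 \<Longrightarrow> eta t * eta t = 1"
  using ind_K_mod_4[of t] by (auto simp: eta_def oct_sgn_def) presburger

text \<open>Multiplying by a unit of \<open>K\<close> shifts the index by a multiple of 4, and such
  shifts only change the sign of \<open>oct_sgn\<close>.\<close>

lemma oct_sgn_ind_mult:
  assumes "t \<in> K" "t \<noteq> 0" "y \<noteq> 0"
  shows "oct_sgn (ind (t * y) - k) = eta t * oct_sgn (ind y - k)"
proof -
  have "(ind (t * y) - k) mod 8 = (ind t + (ind y - k)) mod 8"
    using ind_mult_8[of t y] assms by (metis add_diff_eq mod_diff_left_eq)
  then have "oct_sgn (ind (t * y) - k) = oct_sgn (ind t + (ind y - k))" by (rule oct_sgn_cong)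
  also have "\<dots> = oct_sgn (ind t) * oct_sgn (ind y - k)"
    using ind_K_mod_4[of t] assms by (intro oct_sgn_add_mult_4) auto
  finally show ?thesis using assms by (simp add: eta_def)
qed

lemma eta_mult: "s \<in> K \<Longrightarrow> t \<in> K \<Longrightarrow> eta (s * t) = eta s * eta t"
  using oct_sgn_ind_mult[of s t 0] by (auto simp: eta_def)

lemma sum_eta: "(\<Sum>t\<in>K. eta t) = 0"
proof -
  have "(\<Sum>t\<in>K. eta t) = (\<Sum>t\<in>K - {0}. eta t)"
    by (rule sum.mono_neutral_right) auto
  also have "\<dots> = (\<Sum>j<q - 1. eta (g ^ ((q + 1) * j)))" by (rule sum_K_units)
  \<comment> \<open>The generator \<open>g ^ (q + 1)\<close> of the units of \<open>K\<close> has
    index 4 modulo 8, so the signs alternate along its powers; their number \<open>q - 1\<close> is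
    even.\<close>
  also have "\<dots> = (\<Sum>j<q - 1. (- 1) ^ j)"
  proof (rule sum.cong)
    fix j
    have "(q + 1) mod 8 = 4" using q_mod_8 by presburger
    have "lg (g ^ ((q + 1) * j)) mod 8 = (q + 1) * j mod 8"
      unfolding lg_g_power by (rule mod_mod_cancel[OF eight_dvd_N])
    also have "(q + 1) * j mod 8 = (4 * j) mod 8"
      using \<open>(q + 1) mod 8 = 4\<close> by (metis mod_mult_left_eq)
    finally have "oct_sgn (ind (g ^ ((q + 1) * j))) = oct_sgn (int (4 * j))"
      unfolding ind_def by (intro oct_sgn_cong) (metis of_nat_mod of_nat_numeral)
    also have "\<dots> = (- 1) ^ j"
      by (cases "even j") (auto simp: oct_sgn_def elim!: evenE oddE)
    finally show "eta (g ^ ((q + 1) * j)) = (- 1) ^ j" using g_nonzero by (simp add: eta_def)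
  qed simp
  also have "\<dots> = 0"
  proof -
    have "(\<Sum>j<2 * n. (- 1) ^ j) = (0::int)" for n by (induction n) auto
    moreover have "even (q - 1)" using q_odd by simp
    ultimately show ?thesis by (metis evenE)
  qed
  finally show ?thesis .
qed

text \<open>The logarithm of -1 is half of \<open>N\<close>, and \<open>N\<close> is 8 modulo 16
  because \<open>q\<close> is 3 modulo 8.\<close>

lemma ind_minus_1: "ind (-1) mod 8 = 4"
proof -
  have "lg (-1) \<noteq> 0"
  proof
    assume "lg (-1) = 0"
    then have "(1::'a) = -1" using g_power_lg[of "-1"] by simp
    then have "(2::'a) = 0" by (metis add.right_inverse one_add_one)
    then show False using two_nonzero by simp
  qed
  have "N dvd 2 * lg (-1)"
    using lg_power[of "-1" 2] lg_1 by (simp add: dvd_eq_mod_eq_0)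
  then obtain m where m: "2 * lg (-1) = N * m" by blast
  have "lg (-1) < N" by (rule lg_less) simp
  have "m = 1"
  proof -
    have "N * m < N * 2" using m \<open>lg (-1) < N\<close> by linarith
    then have "m < 2" by simp
    moreover have "m \<noteq> 0" using m \<open>lg (-1) \<noteq> 0\<close> by (metis mult_is_0 zero_neq_numeral)
    ultimately show ?thesis by simp
  qed
  then have l: "2 * lg (-1) = N" using m by simp
  obtain s where s: "q = 8 * s + 3" using q_mod_8 by (metis mult_div_mod_eq)
  have "N = 2 * (8 * (4 * s\<^sup>2 + 3 * s) + 4)" unfolding N_def unfolding s by (simp add: power2_eq_square algebra_simps)
  then have "lg (-1) = 8 * (4 * s\<^sup>2 + 3 * s) + 4" using l by simp
  then show ?thesis unfolding ind_def by presburger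
qed

lemma eta_minus: "t \<in> K \<Longrightarrow> eta (- t) = - eta t"
proof -
  assume "t \<in> K"
  have "eta (-1) = -1" using ind_minus_1 by (simp add: eta_def oct_sgn_def)
  moreover have "-1 \<in> K" using K_simps by simp
  ultimately show ?thesis using eta_mult[of "-1" t] \<open>t \<in> K\<close> by simp
qed

text \<open>For \<open>t\<close> nonzero, the product equals \<open>eta\<close> of the quotient
  \<open>(s + t) / s\<close>, which runs once through every element of \<open>K\<close> except 1.
  The missing value \<open>eta 1\<close> accounts for the -1.\<close>

lemma eta_autocorrelation:
  assumes "t \<in> K"
  shows "(\<Sum>s\<in>K. eta (s + t) * eta s) = (if t = 0 then int q else 0) - 1"
proof (cases "t = 0")
  case True
  have "(\<Sum>s\<in>K. eta s * eta s) = (\<Sum>s\<in>K - {0}. eta s * eta s)"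
    by (rule sum.mono_neutral_right) auto
  also have "\<dots> = (\<Sum>s\<in>K - {0}. 1)" by (rule sum.cong) (auto simp: eta_square)
  also have "\<dots> = int q - 1" using card_K q_ge_3 K_simps(1) by (simp add: of_nat_diff)
  finally show ?thesis using True by simp
next
  case False
  have "(\<Sum>s\<in>K. eta (s + t) * eta s) = (\<Sum>s\<in>K - {0}. eta (s + t) * eta s)"
    by (rule sum.mono_neutral_right) auto
  also have "\<dots> = (\<Sum>w\<in>K - {1}. eta w)"
  proof (rule sum.reindex_bij_witness[of _ "\<lambda>w. t / (w - 1)" "\<lambda>s. (s + t) / s"])
    fix s assume s: "s \<in> K - {0}"
    then have "eta (s + t) = eta ((s + t) / s) * eta s"
      using eta_mult[of "(s + t) / s" s] K_simps assms by simp
    then show "eta ((s + t) / s) = eta (s + t) * eta s" using s eta_square[of s] by simp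
    show "(s + t) / s \<in> K - {1}" using s False assms K_simps by (auto simp: divide_eq_eq)
    show "t / ((s + t) / s - 1) = s" using s False by (simp add: field_simps)
  next
    fix w assume w: "w \<in> K - {1}"
    then have "w - 1 \<noteq> 0" by simp
    then show "(t / (w - 1) + t) / (t / (w - 1)) = w" using False by (simp add: field_simps)
    show "t / (w - 1) \<in> K - {0}" using w False assms K_simps by auto
  qed
  also have "\<dots> = (\<Sum>w\<in>K. eta w) - eta 1" using K_simps(2) by (simp add: sum_diff1)
  finally show ?thesis using False sum_eta eta_1 by simp
qed

section \<open>The trace to \<open>K\<close> and its kernel\<close>

definition tr :: "'a \<Rightarrow> 'a" where "tr x = x + x ^ q"

lemma tr_in_K: "tr x \<in> K"
  by (simp add: K_def tr_def frobenius_add frobenius_frobenius add.commute)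

lemma tr_add: "tr (x + y) = tr x + tr y"
  and tr_diff: "tr (x - y) = tr x - tr y"
  and tr_0 [simp]: "tr 0 = 0"
  using q_ge_3 by (simp_all add: tr_def frobenius_add frobenius_diff)

lemma tr_mult_K: "k \<in> K \<Longrightarrow> tr (k * x) = k * tr x"
  by (simp add: tr_def K_def power_mult_distrib algebra_simps)

text \<open>A square root of the generator \<open>g ^ (q + 1)\<close> of the units of
  \<open>K\<close>; it spans the kernel of the trace.\<close>

definition y0 :: 'a where "y0 = g ^ ((q + 1) div 2)"

lemma y0_nonzero: "y0 \<noteq> 0" using g_nonzero by (simp add: y0_def)

text \<open>Both sides are square roots of the same element of \<open>K\<close>, and the sign is
  negative because \<open>y0\<close> is not itself in \<open>K\<close>.\<close>

lemma y0_frobenius: "y0 ^ q = - y0"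
proof -
  have e: "2 * ((q + 1) div 2) = q + 1" using q_odd by simp
  have "y0\<^sup>2 = g ^ (q + 1)" unfolding y0_def power_mult[symmetric] using e by (simp only: mult.commute)
  then have sq: "y0\<^sup>2 \<in> K" 
    using K_iff_lg[of "g ^ (q + 1)"] g_nonzero dvd_mod[of "q + 1" "q + 1" N]
    by (simp only: lg_g_power N_eq dvd_triv_right dvd_refl power_eq_0_iff simp_thms)
  have "(y0 ^ q)\<^sup>2 = y0\<^sup>2" using sq by (simp add: K_def power_mult[symmetric] mult.commute)
  then have "y0 ^ q = y0 \<or> y0 ^ q = - y0" by (simp add: power2_eq_iff)
  moreover have "y0 \<notin> K"
  proof
    assume "y0 \<in> K"
    then have "(q + 1) dvd lg y0" using K_iff_lg y0_nonzero by blast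
    moreover have "lg y0 = ((q + 1) div 2) mod N" unfolding y0_def by (rule lg_g_power)
    ultimately have "(q + 1) dvd (q + 1) div 2" by (simp only: N_eq dvd_mod_iff dvd_triv_right)
    then show False using q_ge_3 by (metis e dvd_imp_le mult_is_0 neq0_conv nat_dvd_not_less add_is_0 lessI less_add_same_cancel1 mult_2 one_neq_zero)
  qed
  ultimately show ?thesis by (simp add: K_def)
qed

lemma ind_y0: "ind y0 mod 4 = 2"
proof -
  have "(q + 1) div 2 mod 4 = 2" using q_mod_8 by presburger
  moreover have "4 dvd N" using eight_dvd_N by presburger
  ultimately have "lg y0 mod 4 = 2" unfolding y0_def lg_g_power by (simp add: mod_mod_cancel)
  then show ?thesis unfolding ind_def by presburger
qed

lemma tr_eq_0_iff: "tr y = 0 \<longleftrightarrow> y / y0 \<in> K"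
proof -
  have "(y / y0) ^ q = - (y ^ q) / y0" by (simp add: power_divide y0_frobenius)
  then have "y / y0 \<in> K \<longleftrightarrow> - (y ^ q) = y"
    using y0_nonzero by (simp only: K_def mem_Collect_eq divide_cancel_right simp_thms)
  then show ?thesis by (auto simp: tr_def add_eq_0_iff2)
qed

section \<open>Affine lines over \<open>K\<close>\<close>

definition H :: "'a \<Rightarrow> 'a \<Rightarrow> 'a set" where "H d t = {y. tr (d * y) = t}"

lemma sum_H_0:
  assumes "d \<noteq> 0" shows "(\<Sum>y\<in>H d 0. f y) = (\<Sum>k\<in>K. f (k * (y0 / d)))"
  by (rule sum.reindex_bij_witness[of _ "\<lambda>k. k * (y0 / d)" "\<lambda>y. d * y / y0"])
    (use assms y0_nonzero in \<open>auto simp: H_def tr_eq_0_iff\<close>)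

lemma sum_H_scale:
  assumes "t \<in> K" "t \<noteq> 0" shows "(\<Sum>y\<in>H d t. f y) = (\<Sum>y\<in>H d 1. f (t * y))"
proof (rule sum.reindex_bij_witness[of _ "\<lambda>y. t * y" "\<lambda>y. y / t"])
  fix y assume "y \<in> H d t"
  then have "t * tr (d * (y / t)) = t"
    unfolding tr_mult_K[OF assms(1), symmetric] using assms by (simp add: H_def)
  then have "tr (d * (y / t)) = 1" using assms(2) by simp
  then show "y / t \<in> H d 1" by (simp only: H_def mem_Collect_eq)
next
  fix y assume "y \<in> H d 1"
  then show "t * y \<in> H d t" using tr_mult_K[OF assms(1), of "d * y"] by (simp add: H_def mult.left_commute)
qed (use assms in auto)

lemma card_H_0: "d \<noteq> 0 \<Longrightarrow> card (H d 0) = q"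
  using sum_H_0[of d "\<lambda>_. 1::nat"] card_K by simp

lemma card_H:
  assumes "d \<noteq> 0" "t \<in> K" shows "card (H d t) = q"
proof -
  \<comment> \<open>A point on the line: the trace doubles elements of \<open>K\<close>, so
    \<open>t / 2\<close> has trace \<open>t\<close>. The line is then a translate of its parallel
    through 0.\<close>
  define b where "b = t / (2 * d)"
  have "t ^ q = t" using assms by (simp add: K_def)
  moreover have "(2::'a) ^ q = 2" using frobenius_add[of 1 1] by simp
  ultimately have b: "tr (d * b) = t"
    using assms(1) two_nonzero by (simp add: b_def tr_def power_divide field_simps)
  have "H d t = (\<lambda>y. b + y) ` H d 0"
  proof (intro equalityI subsetI)
    fix y assume "y \<in> H d t"
    then have "y - b \<in> H d 0" using b by (simp add: H_def algebra_simps tr_diff[of "d * y"])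
    then show "y \<in> (\<lambda>y. b + y) ` H d 0" by (metis add_diff_cancel_left' add.commute diff_add_cancel image_eqI)
  qed (use b in \<open>auto simp: H_def distrib_left tr_add\<close>)
  then have "card (H d t) = card (H d 0)" by (simp add: card_image)
  then show ?thesis using card_H_0[OF assms(1)] by simp
qed

lemma sum_H_all: "(\<Sum>t\<in>K. \<Sum>y\<in>H d t. f y) = (\<Sum>y\<in>UNIV. f y)"
proof -
  have "(\<Sum>t\<in>K. \<Sum>y\<in>H d t. f y) = (\<Sum>t\<in>K. \<Sum>y\<in>{y\<in>UNIV. tr (d * y) = t}. f y)" by (simp add: H_def)
  also have "\<dots> = (\<Sum>y\<in>UNIV. f y)" by (rule sum.group) (auto simp: tr_in_K)
  finally show ?thesis .
qed

end

subsection \<open>Line sums and correlations\<close>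

definition corr :: "('a::ab_group_add \<Rightarrow> int) \<Rightarrow> ('a \<Rightarrow> int) \<Rightarrow> 'a \<Rightarrow> int" where
  "corr f h u = (\<Sum>v\<in>UNIV. f (v + u) * h v)"

context quadratic_extension
begin

section \<open>Functions with prescribed line sums\<close>

definition proj :: "('a \<Rightarrow> int) \<Rightarrow> 'a \<Rightarrow> 'a \<Rightarrow> int" where
  "proj f d t = (\<Sum>y\<in>H d t. f y)"

definition projects :: "('a \<Rightarrow> int) \<Rightarrow> ('a \<Rightarrow> int) \<Rightarrow> ('a \<Rightarrow> int) \<Rightarrow> ('a \<Rightarrow> int) \<Rightarrow> bool" where
  "projects f r m T \<longleftrightarrow> (\<forall>d t. d \<noteq> 0 \<longrightarrow> t \<in> K \<longrightarrow>
     proj f d t = (if t = 0 then r d else 0) + m d + T d * eta t)"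

text \<open>For the invariant part \<open>e\<close>, all lines of one direction that miss 0 have
  equal sums, and the total determines their value. For \<open>p\<close>, the line through 0 has sum
  0 because \<open>eta\<close> sums to 0 over \<open>K\<close>, and the other lines are scalar
  multiples of the line with \<open>t = 1\<close>.\<close>

lemma projects_even_odd:
  assumes even: "\<And>k y. k \<in> K \<Longrightarrow> k \<noteq> 0 \<Longrightarrow> e (k * y) = e y" and "e 0 = 0"
    and odd: "\<And>k y. k \<in> K \<Longrightarrow> p (k * y) = eta k * p y"
    and M: "(\<Sum>y\<in>UNIV. e y) = int (q - 1) * M"
    and f: "\<And>y. f y = (if y = 0 then c else 0) + e y + p y"
  shows "projects f (\<lambda>d. c - M + int q * e (y0 / d)) (\<lambda>d. M - e (y0 / d)) (\<lambda>d. proj p d 1)"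
  unfolding projects_def
proof (intro allI impI)
  fix d t :: 'a assume d: "d \<noteq> 0" and t: "t \<in> K"
  have q1: "int (q - 1) = int q - 1" using q_ge_3 by simp
  have cardK0: "card (K - {0}) = q - 1" using card_K K_simps(1) by simp
  have even0: "proj e d 0 = int (q - 1) * e (y0 / d)"
  proof -
    have "proj e d 0 = (\<Sum>k\<in>K. e (k * (y0 / d)))" unfolding proj_def by (rule sum_H_0[OF d])
    also have "\<dots> = (\<Sum>k\<in>K - {0}. e (k * (y0 / d)))"
      by (rule sum.mono_neutral_right) (use \<open>e 0 = 0\<close> in auto)
    also have "\<dots> = (\<Sum>k\<in>K - {0}. e (y0 / d))"
      by (rule sum.cong[OF refl even]) auto
    finally show ?thesis using cardK0 by simp
  qed
  have even1: "proj e d s = proj e d 1" if "s \<in> K" "s \<noteq> 0" for s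
    unfolding proj_def using sum_H_scale[OF that, of e d] even[OF that] by simp
  have "(\<Sum>y\<in>UNIV. e y) = (\<Sum>s\<in>K. proj e d s)" unfolding proj_def by (simp add: sum_H_all)
  also have "\<dots> = proj e d 0 + (\<Sum>s\<in>K - {0}. proj e d s)" using K_simps(1) by (simp add: sum.remove)
  also have "(\<Sum>s\<in>K - {0}. proj e d s) = (\<Sum>s\<in>K - {0}. proj e d 1)" by (rule sum.cong) (use even1 in auto)
  finally have "int (q - 1) * M = int (q - 1) * (e (y0 / d) + proj e d 1)"
    using cardK0 even0 M by (simp add: distrib_left)
  then have even_1: "proj e d 1 = M - e (y0 / d)" using q_ge_3 by simp
  have projf: "proj f d t = (\<Sum>y\<in>H d t. if y = 0 then c else 0) + proj e d t + proj p d t"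
    unfolding proj_def by (simp add: f sum.distrib)
  have delta: "(\<Sum>y\<in>H d t. if y = 0 then c else 0) = (if t = 0 then c else 0)"
    by (subst sum.delta) (auto simp: H_def)
  have oddt: "proj p d t = eta t * proj p d 1"
  proof (cases "t = 0")
    case True
    have "proj p d 0 = (\<Sum>k\<in>K. p (k * (y0 / d)))" unfolding proj_def by (rule sum_H_0[OF d])
    also have "\<dots> = (\<Sum>k\<in>K. eta k * p (y0 / d))" by (rule sum.cong[OF refl odd])
    also have "\<dots> = 0" by (simp add: sum_eta flip: sum_distrib_right)
    finally show ?thesis using True by simp
  next
    case False
    then show ?thesis unfolding proj_def using sum_H_scale[OF t False, of p d] odd[OF t]
      by (simp add: sum_distrib_left)
  qed
  show "proj f d t = (if t = 0 then c - M + int q * e (y0 / d) else 0) + (M - e (y0 / d)) + proj p d 1 * eta t"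
  proof (cases "t = 0")
    case True
    then show ?thesis using projf delta oddt even0 unfolding q1 by (simp add: algebra_simps)
  next
    case False
    then show ?thesis using projf delta oddt even_1 even1[OF t False] by simp
  qed
qed

lemma projects_uminus:
  "projects f r m T \<Longrightarrow> projects (\<lambda>y. - f y) (\<lambda>d. - r d) (\<lambda>d. - m d) (\<lambda>d. - T d)"
  unfolding projects_def proj_def by (auto simp: sum_negf)

lemma projects_total:
  assumes "projects f r m T" "d \<noteq> 0"
  shows "(\<Sum>y\<in>UNIV. f y) = r d + int q * m d"
proof -
  have "(\<Sum>y\<in>UNIV. f y) = (\<Sum>t\<in>K. proj f d t)" unfolding proj_def by (simp add: sum_H_all)
  also have "\<dots> = (\<Sum>t\<in>K. (if t = 0 then r d else 0) + m d + T d * eta t)"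
    by (rule sum.cong) (use assms in \<open>auto simp: projects_def\<close>)
  also have "\<dots> = r d + int q * m d"
    using K_simps(1) card_K sum_eta by (simp add: sum.distrib flip: sum_distrib_left)
  finally show ?thesis .
qed

section \<open>Line sums of correlations and Radon inversion\<close>

text \<open>The map sending \<open>y\<close> to \<open>tr (d * y)\<close> is additive, so summing
  over its fibres turns a correlation on the field into a correlation on \<open>K\<close>.\<close>

lemma proj_corr:
  assumes "t \<in> K"
  shows "(\<Sum>u\<in>H d t. corr f h u) = (\<Sum>s\<in>K. proj f d (s + t) * proj h d s)"
proof -
  have shift: "(\<Sum>u\<in>H d t. f (v + u)) = proj f d (tr (d * v) + t)" for v
    unfolding proj_def
    by (rule sum.reindex_bij_witness[of _ "\<lambda>w. w - v" "\<lambda>u. v + u"])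
      (auto simp: H_def distrib_left right_diff_distrib tr_add tr_diff)
  have "(\<Sum>u\<in>H d t. corr f h u) = (\<Sum>v\<in>UNIV. \<Sum>u\<in>H d t. f (v + u) * h v)"
    unfolding corr_def by (rule sum.swap)
  also have "\<dots> = (\<Sum>v\<in>UNIV. proj f d (tr (d * v) + t) * h v)"
    by (simp add: shift flip: sum_distrib_right)
  also have "\<dots> = (\<Sum>s\<in>K. \<Sum>v\<in>H d s. proj f d (tr (d * v) + t) * h v)"
    by (simp only: sum_H_all)
  also have "\<dots> = (\<Sum>s\<in>K. \<Sum>v\<in>H d s. proj f d (s + t) * h v)"
    by (intro sum.cong refl) (simp add: H_def)
  also have "\<dots> = (\<Sum>s\<in>K. proj f d (s + t) * proj h d s)"
    by (simp add: proj_def sum_distrib_left)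
  finally show ?thesis .
qed

lemma sum_K_shift:
  assumes "t \<in> K" shows "(\<Sum>s\<in>K. f (s + t)) = (\<Sum>s\<in>K. f s)"
  by (rule sum.reindex_bij_witness[of _ "\<lambda>s. s - t" "\<lambda>s. s + t"]) (use assms K_simps in auto)

text \<open>The terms linear in \<open>eta t\<close> are antisymmetric in the two functions, so they
  cancel when both orders are added. The symmetric sum is also what a nonzero first coordinate of a
  difference produces.\<close>

lemma proj_sym_corr:
  assumes f: "projects f r m T" and h: "projects h r' m' T'" and d: "d \<noteq> 0" and t: "t \<in> K"
  shows "(\<Sum>u\<in>H d t. corr f h u + corr h f u) =
     2 * ((if t = 0 then r d * r' d + int q * (T d * T' d) else 0)
       + (r d * m' d + m d * r' d + int q * (m d * m' d) - T d * T' d))"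
proof -
  have one: "(\<Sum>u\<in>H d t. corr f h u) =
      (if t = 0 then r d * r' d else 0) + r d * m' d + m d * r' d + int q * (m d * m' d)
      + (T d * r' d - r d * T' d) * eta t + T d * T' d * ((if t = 0 then int q else 0) - 1)"
    if f: "projects f r m T" and h: "projects h r' m' T'" for f h r m T r' m' T'
  proof -
    let ?\<delta> = "\<lambda>s::'a. if s = 0 then 1 else 0 :: int"
    have neg: "-t \<in> K" using t K_simps by simp
    have "(\<Sum>u\<in>H d t. corr f h u) = (\<Sum>s\<in>K. (r d * ?\<delta> (s + t) + m d + T d * eta (s + t)) *
        (r' d * ?\<delta> s + m' d + T' d * eta s))"
      unfolding proj_corr[OF t]
    proof (rule sum.cong[OF refl])
      fix s assume "s \<in> K"
      then show "proj f d (s + t) * proj h d s = (r d * ?\<delta> (s + t) + m d + T d * eta (s + t)) *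
        (r' d * ?\<delta> s + m' d + T' d * eta s)"
        using f h d t K_simps(3)[of s t] unfolding projects_def by simp
    qed
    also have "\<dots> = (\<Sum>s\<in>K. r d * r' d * (?\<delta> (s + t) * ?\<delta> s) + r d * m' d * ?\<delta> (s + t)
        + r d * T' d * (?\<delta> (s + t) * eta s) + m d * r' d * ?\<delta> s + m d * m' d + m d * T' d * eta s
        + T d * r' d * (?\<delta> s * eta (s + t)) + T d * m' d * eta (s + t) + T d * T' d * (eta (s + t) * eta s))"
      by (intro sum.cong refl) (simp only: algebra_simps)
    also have "\<dots> = r d * r' d * (\<Sum>s\<in>K. ?\<delta> (s + t) * ?\<delta> s) + r d * m' d * (\<Sum>s\<in>K. ?\<delta> (s + t))
        + r d * T' d * (\<Sum>s\<in>K. ?\<delta> (s + t) * eta s) + m d * r' d * (\<Sum>s\<in>K. ?\<delta> s)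
        + int q * (m d * m' d) + m d * T' d * (\<Sum>s\<in>K. eta s)
        + T d * r' d * (\<Sum>s\<in>K. ?\<delta> s * eta (s + t)) + T d * m' d * (\<Sum>s\<in>K. eta (s + t))
        + T d * T' d * (\<Sum>s\<in>K. eta (s + t) * eta s)"
      by (simp only: sum.distrib sum_distrib_left sum_constant card_K)
    also have "(\<Sum>s\<in>K. ?\<delta> s) = 1" using K_simps(1) by simp
    also have "(\<Sum>s\<in>K. ?\<delta> (s + t)) = 1" using K_simps(1) sum_K_shift[OF t, of ?\<delta>] by simp
    also have "(\<Sum>s\<in>K. eta (s + t)) = 0" using sum_K_shift[OF t, of eta] sum_eta by simp
    also have "(\<Sum>s\<in>K. ?\<delta> s * eta (s + t)) = eta t"
      using sum.delta'[of K 0 "\<lambda>s. eta (s + t)"] K_simps(1) by (simp add: if_distrib[of "\<lambda>x. x * _"] cong: if_cong)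
    also have "(\<Sum>s\<in>K. ?\<delta> (s + t) * ?\<delta> s) = (if t = 0 then 1 else 0)"
      using K_simps(1) by (simp add: if_distrib[of "\<lambda>x. _ * x"] cong: if_cong)
    \<comment> \<open>The minus sign, due to \<open>eta\<close> being odd, is the source of that
      antisymmetry.\<close>
    also have "(\<Sum>s\<in>K. ?\<delta> (s + t) * eta s) = - eta t"
    proof -
      have "?\<delta> (s + t) * eta s = (if s = - t then eta s else 0)" for s
        by (auto simp: add_eq_0_iff2)
      then show ?thesis using neg eta_minus[OF t] by simp
    qed
    also have "(\<Sum>s\<in>K. eta (s + t) * eta s) = (if t = 0 then int q else 0) - 1"
      by (rule eta_autocorrelation[OF t])
    finally show ?thesis using sum_eta by (simp add: algebra_simps)
  qed
  show ?thesis unfolding sum.distrib one[OF f h] one[OF h f]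
    by (cases "t = 0") (simp_all add: algebra_simps)
qed

text \<open>Add the sums over all lines through \<open>v\<close>, indexed by the nonzero
  \<open>d\<close>. The point \<open>v\<close> is counted \<open>N\<close> times and every other
  point \<open>q - 1\<close> times; as the total of \<open>E\<close> is 0 too, only a nonzero
  multiple of \<open>E v\<close> remains.\<close>

lemma radon_inversion:
  fixes E :: "'a \<Rightarrow> int"
  assumes "\<And>d t. d \<noteq> 0 \<Longrightarrow> t \<in> K \<Longrightarrow> (\<Sum>u\<in>H d t. E u) = 0"
  shows "E v = 0"
proof -
  have tot: "(\<Sum>u\<in>UNIV. E u) = 0"
    using assms[of 1] sum_H_all[of E 1] by simp
  have cnt: "card {d \<in> UNIV - {0}. u \<in> H d (tr (d * v))} = (if u = v then N else q - 1)" for u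
  proof (cases "u = v")
    case True
    then have "{d \<in> UNIV - {0}. u \<in> H d (tr (d * v))} = UNIV - {0}" by (auto simp: H_def)
    then show ?thesis using True card_units by simp
  next
    case False
    \<comment> \<open>The condition \<open>tr (d * (u - v)) = 0\<close> is symmetric in
      \<open>d\<close> and \<open>u - v\<close>, so the admissible \<open>d\<close> form a punctured
      line through 0.\<close>
    have "{d \<in> UNIV - {0}. u \<in> H d (tr (d * v))} = H (u - v) 0 - {0}"
      by (auto simp: H_def tr_diff right_diff_distrib mult.commute[of "u - v"])
    moreover have "0 \<in> H (u - v) 0" by (simp add: H_def)
    ultimately show ?thesis using False card_H_0[of "u - v"] by simp
  qed
  have "0 = (\<Sum>d\<in>UNIV - {0}. \<Sum>u\<in>H d (tr (d * v)). E u)"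
    using assms tr_in_K by simp
  also have "\<dots> = (\<Sum>d\<in>UNIV - {0}. \<Sum>u\<in>UNIV. if u \<in> H d (tr (d * v)) then E u else 0)"
  proof (rule sum.cong[OF refl])
    fix d
    show "(\<Sum>u\<in>H d (tr (d * v)). E u) = (\<Sum>u\<in>UNIV. if u \<in> H d (tr (d * v)) then E u else 0)"
      using sum.inter_restrict[of UNIV E "H d (tr (d * v))"] by simp
  qed
  also have "\<dots> = (\<Sum>u\<in>UNIV. \<Sum>d\<in>UNIV - {0}. if u \<in> H d (tr (d * v)) then E u else 0)"
    by (rule sum.swap)
  also have "\<dots> = (\<Sum>u\<in>UNIV. int (card {d \<in> UNIV - {0}. u \<in> H d (tr (d * v))}) * E u)"
  proof (intro sum.cong refl)
    fix u
    have "(\<Sum>d\<in>UNIV - {0}. if u \<in> H d (tr (d * v)) then E u else 0) =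
        (\<Sum>d\<in>{d \<in> UNIV - {0}. u \<in> H d (tr (d * v))}. E u)"
      by (subst sum.inter_filter) auto
    then show "(\<Sum>d\<in>UNIV - {0}. if u \<in> H d (tr (d * v)) then E u else 0) =
        int (card {d \<in> UNIV - {0}. u \<in> H d (tr (d * v))}) * E u" by simp
  qed
  also have "\<dots> = (\<Sum>u\<in>UNIV. int (q - 1) * E u + (if u = v then (int N - int (q - 1)) * E u else 0))"
    unfolding cnt by (intro sum.cong refl) (simp add: algebra_simps)
  also have "\<dots> = (int N - int (q - 1)) * E v"
    by (simp add: sum.distrib tot flip: sum_distrib_left)
  finally have "(int N - int (q - 1)) * E v = 0" by simp
  moreover have "(q - 1) * 1 < N" unfolding N_eq by (rule mult_strict_left_mono) (use q_ge_3 in simp_all)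
  ultimately show ?thesis by simp
qed

text \<open>Reduces a statement about correlations to one identity in \<open>r\<close> and
  \<open>T\<close> for each direction and one identity between totals. The contribution of the
  constants \<open>m\<close> is deduced from these two, and Radon inversion does the rest.\<close>

lemma sum_corr_eq:
  assumes "finite I"
    and f: "\<And>i. i \<in> I \<Longrightarrow> projects (f i) (r i) (m i) (T i)"
    and h: "\<And>i. i \<in> I \<Longrightarrow> projects (h i) (r' i) (m' i) (T' i)"
    and nrm: "\<And>d. d \<noteq> 0 \<Longrightarrow> (\<Sum>i\<in>I. r i d * r' i d + int q * (T i d * T' i d)) = A"
    and tot: "(\<Sum>i\<in>I. (\<Sum>y\<in>UNIV. f i y) * (\<Sum>y\<in>UNIV. h i y)) = A + int (q\<^sup>2) * B"
  shows "(\<Sum>i\<in>I. corr (f i) (h i) u + corr (h i) (f i) u) = (if u = 0 then 2 * A else 0) + 2 * B"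
proof -
  let ?E = "\<lambda>u. (\<Sum>i\<in>I. corr (f i) (h i) u + corr (h i) (f i) u) - ((if u = 0 then 2 * A else 0) + 2 * B)"
  have "?E u = 0"
  proof (rule radon_inversion[of ?E u])
    fix d t :: 'a assume d: "d \<noteq> 0" and t: "t \<in> K"
    define c where "c = (\<Sum>i\<in>I. r i d * m' i d + m i d * r' i d + int q * (m i d * m' i d) - T i d * T' i d)"
    \<comment> \<open>The totals do not depend on \<open>d\<close>; expanding their products and
      subtracting the norm condition determines \<open>c\<close>.\<close>
    have "A + int (q\<^sup>2) * B = (\<Sum>i\<in>I. (r i d + int q * m i d) * (r' i d + int q * m' i d))"
      unfolding tot[symmetric] using projects_total[OF f d] projects_total[OF h d] by simp
    also have "\<dots> = (\<Sum>i\<in>I. (r i d * r' i d + int q * (T i d * T' i d)) + int q *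
        (r i d * m' i d + m i d * r' i d + int q * (m i d * m' i d) - T i d * T' i d))"
      by (intro sum.cong refl) (simp add: algebra_simps)
    also have "\<dots> = A + int q * c" unfolding c_def using nrm[OF d] by (simp add: sum.distrib sum_distrib_left)
    finally have "int q * c = int q * (int q * B)" by (auto simp: power2_eq_square)
    then have c: "c = int q * B" using q_ge_3 by auto
    have "(\<Sum>u\<in>H d t. \<Sum>i\<in>I. corr (f i) (h i) u + corr (h i) (f i) u) =
        (\<Sum>i\<in>I. \<Sum>u\<in>H d t. corr (f i) (h i) u + corr (h i) (f i) u)" by (rule sum.swap)
    also have "\<dots> = (\<Sum>i\<in>I. 2 * ((if t = 0 then r i d * r' i d + int q * (T i d * T' i d) else 0)
       + (r i d * m' i d + m i d * r' i d + int q * (m i d * m' i d) - T i d * T' i d)))"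
      by (intro sum.cong refl proj_sym_corr f h d t)
    also have "\<dots> = 2 * ((if t = 0 then A else 0) + c)"
    proof -
      have "(\<Sum>i\<in>I. 2 * ((if t = 0 then x i else 0) + y i)) = 2 * ((if t = 0 then sum x I else 0) + sum y I)"
        for x y :: "_ \<Rightarrow> int"
        by (simp add: sum.distrib flip: sum_distrib_left)
      then show ?thesis unfolding c_def nrm[OF d, symmetric] .
    qed
    also have "\<dots> = (if t = 0 then 2 * A else 0) + 2 * c" by simp
    finally have 1: "(\<Sum>u\<in>H d t. \<Sum>i\<in>I. corr (f i) (h i) u + corr (h i) (f i) u) =
      (if t = 0 then 2 * A else 0) + 2 * c" .
    have 2: "(\<Sum>u\<in>H d t. (if u = 0 then 2 * A else 0) + 2 * B) = (if t = 0 then 2 * A else 0) + 2 * (int q * B)"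
    proof -
      have "(\<Sum>u\<in>H d t. if u = 0 then 2 * A else 0) = (if t = 0 then 2 * A else 0)"
        by (subst sum.delta) (auto simp: H_def)
      then show ?thesis using card_H[OF d t] by (simp add: sum.distrib)
    qed
    show "(\<Sum>u\<in>H d t. ?E u) = 0" unfolding sum_subtractf 1 2 c by simp
  qed
  then show ?thesis by simp
qed

end

subsection \<open>Octic line sums\<close>

text \<open>Exactly one of the four shifts of \<open>a\<close> is nonzero, and likewise for
  \<open>b\<close>. They are the same shift exactly when \<open>a\<close> and \<open>b\<close> agree
  modulo 4, and then the product of the signs depends on \<open>a - b\<close> only.\<close>

lemma oct_sgn_orthogonal:
  "oct_sgn a * oct_sgn b + oct_sgn (a - 1) * oct_sgn (b - 1) + oct_sgn (a - 2) * oct_sgn (b - 2)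
    + oct_sgn (a - 3) * oct_sgn (b - 3) = oct_sgn (a - b)"
proof -
  have red: "oct_sgn (a - k) = oct_sgn (a mod 8 - k)" for a k
    by (rule oct_sgn_cong) (simp add: mod_diff_left_eq)
  have red2: "oct_sgn (a - b) = oct_sgn (a mod 8 - b mod 8)"
    by (rule oct_sgn_cong) (simp add: mod_diff_eq)
  have range: "x mod 8 \<in> {0, 1, 2, 3, 4, 5, 6, 7}" for x :: int by auto
  have "oct_sgn x * oct_sgn y + oct_sgn (x - 1) * oct_sgn (y - 1) + oct_sgn (x - 2) * oct_sgn (y - 2)
      + oct_sgn (x - 3) * oct_sgn (y - 3) = oct_sgn (x - y)"
    if "x \<in> {0, 1, 2, 3, 4, 5, 6, 7}" "y \<in> {0, 1, 2, 3, 4, 5, 6, 7}" for x y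
  proof -
    have "oct_sgn 0 = 1" "oct_sgn 1 = 0" "oct_sgn 2 = 0" "oct_sgn 3 = 0" "oct_sgn 4 = - 1"
      "oct_sgn 5 = 0" "oct_sgn 6 = 0" "oct_sgn 7 = 0" "oct_sgn (- 1) = 0" "oct_sgn (- 2) = 0"
      "oct_sgn (- 3) = 0" "oct_sgn (- 4) = - 1" "oct_sgn (- 5) = 0" "oct_sgn (- 6) = 0" "oct_sgn (- 7) = 0"
      by (simp_all add: oct_sgn_def)
    with that show ?thesis by (elim insertE emptyE) simp_all
  qed
  from this[OF range range, of a b] show ?thesis
    using red[of a 0] red[of b 0] 
    unfolding red2 red[of a 1] red[of a 2] red[of a 3] red[of b 1] red[of b 2] red[of b 3] by simp
qed

text \<open>Expresses an octic character, with values in any commutative ring, through integer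
  coordinates: lowering the exponent by 4 changes the sign on both sides.\<close>

lemma power_eq_sum_oct_sgn:
  fixes w :: "'b::comm_ring_1"
  assumes "w ^ 4 = - 1"
  shows "w ^ a = (\<Sum>k<4. of_int (oct_sgn (int a - int k)) * w ^ k)"
proof (induction a rule: less_induct)
  case (less a)
  show ?case
  proof (cases "a < 4")
    case True
    then have "a \<in> {0, 1, 2, 3}" by auto
    moreover have "oct_sgn 0 = 1" "oct_sgn 1 = 0" "oct_sgn 2 = 0" "oct_sgn 3 = 0"
      "oct_sgn (- 1) = 0" "oct_sgn (- 2) = 0" "oct_sgn (- 3) = 0"
      by (simp_all add: oct_sgn_def)
    ultimately show ?thesis unfolding sum_lessThan_4
      by (elim insertE emptyE) simp_all
  next
    case False
    then obtain b where b: "a = b + 4" by (metis add.commute le_Suc_ex not_less)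
    have "w ^ a = - (w ^ b)" using assms by (simp add: b power_add)
    also have "w ^ b = (\<Sum>k<4. of_int (oct_sgn (int b - int k)) * w ^ k)" using less b by simp
    also have "- \<dots> = (\<Sum>k<4. of_int (oct_sgn (int a - int k)) * w ^ k)"
      unfolding sum_negf[symmetric]
    proof (intro sum.cong refl)
      fix k
      have "int a - int k = (int b - int k) + 4" by (simp add: b)
      then show "- (of_int (oct_sgn (int b - int k)) * w ^ k) = of_int (oct_sgn (int a - int k)) * w ^ k"
        by (simp only: oct_sgn_add_4) simp
    qed
    finally show ?thesis .
  qed
qed

context quadratic_extension
begin

text \<open>The values at 0, 1, 2, 3 are the coordinates of an octic Eisenstein sum, that is, of the
  sum of a character of order 8 over the elements of trace 1.\<close>

definition tau :: "int \<Rightarrow> int" where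
  "tau k = (\<Sum>z\<in>H 1 1. oct_sgn (ind z - k))"

lemma H_nonzero: "z \<in> H d 1 \<Longrightarrow> z \<noteq> 0"
  by (auto simp: H_def)

lemma tau_cong: "k mod 8 = l mod 8 \<Longrightarrow> tau k = tau l"
  unfolding tau_def by (intro sum.cong refl oct_sgn_cong) (metis mod_diff_right_eq)

lemma tau_add_4: "tau (k + 4) = - tau k"
proof -
  have "oct_sgn (x - (k + 4)) = - oct_sgn (x - k)" for x
    using oct_sgn_add_4[of "x - k - 4"] by (simp add: algebra_simps)
  then show ?thesis by (simp add: tau_def sum_negf)
qed

text \<open>The Frobenius map permutes the elements of trace 1 and multiplies indices by
  \<open>q\<close>, which is 3 modulo 8.\<close>

lemma tau_mult_3: "tau (3 * k) = tau k"
proof -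
  have "tau (3 * k) = (\<Sum>z\<in>H 1 1. oct_sgn (ind (z ^ q) - 3 * k))"
    unfolding tau_def
    by (rule sum.reindex_bij_witness[of _ "\<lambda>z. z ^ q" "\<lambda>z. z ^ q"])
      (auto simp: H_def tr_def frobenius_frobenius add.commute)
  also have "\<dots> = (\<Sum>z\<in>H 1 1. oct_sgn (ind z - k))"
  proof (intro sum.cong refl)
    fix z assume "z \<in> H 1 1"
    then have "z \<noteq> 0" by (rule H_nonzero)
    then have "ind (z ^ q) mod 8 = (int q * ind z) mod 8" using ind_power[OF _ eight_dvd_N] by simp
    also have "\<dots> = (3 * ind z) mod 8" using q_mod_8
    proof -
      have "int q mod 8 = 3 mod 8" using q_mod_8 by (simp add: zmod_int[of q 8, simplified, symmetric])
      then show ?thesis by (rule mod_mult_cong) simp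
    qed
    finally have "ind (z ^ q) mod 8 = (3 * ind z) mod 8" .
    then have "(ind (z ^ q) - 3 * k) mod 8 = (3 * ind z - 3 * k) mod 8" by (rule mod_diff_cong) simp
    then have "oct_sgn (ind (z ^ q) - 3 * k) = oct_sgn (3 * (ind z - k))"
      by (intro oct_sgn_cong) (simp add: right_diff_distrib)
    also have "oct_sgn (3 * x) = oct_sgn x" for x
    proof -
      \<comment> \<open>Since 3 is its own inverse modulo 8, only the classes 0 and 4 are sent to 0
        and 4.\<close>
      have "x = 3 * (3 * x) - 8 * x" by simp
      then have inv: "x mod 8 = (3 * ((3 * x) mod 8)) mod 8" by (metis mod_mult_self4 mod_mult_right_eq diff_add_cancel add.commute)
      have "(3 * x) mod 8 = (3 * (x mod 8)) mod 8" by (simp add: mod_mult_right_eq)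
      with inv have "(3 * x) mod 8 = 0 \<longleftrightarrow> x mod 8 = 0" "(3 * x) mod 8 = 4 \<longleftrightarrow> x mod 8 = 4" by auto
      then show ?thesis by (simp add: oct_sgn_def)
    qed
    finally show "oct_sgn (ind (z ^ q) - 3 * k) = oct_sgn (ind z - k)" .
  qed
  finally show ?thesis by (simp add: tau_def)
qed

text \<open>\<open>tau 6\<close> is \<open>tau 2\<close> by Frobenius and \<open>- tau 2\<close>
  because opposite classes carry opposite signs.\<close>

lemma tau_2: "tau 2 = 0"
  using tau_mult_3[of 2] tau_add_4[of 2] by simp

lemma tau_3: "tau 3 = tau 1"
  using tau_mult_3[of 1] by simp

lemma sum_eta_UNIV: "(\<Sum>u\<in>UNIV. eta u) = 0"
proof -
  obtain m where m: "N = 8 * m" using eight_dvd_N by blast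
  have "(\<Sum>u\<in>UNIV. eta u) = (\<Sum>u\<in>UNIV - {0}. eta u)"
    by (rule sum.mono_neutral_right) auto
  also have "\<dots> = (\<Sum>u\<in>UNIV - {0}. oct_sgn (int (lg u)))"
    by (intro sum.cong refl) (simp add: eta_def ind_def)
  also have "\<dots> = (\<Sum>i<8 * m. oct_sgn (int i))"
    using sum_lg[of "\<lambda>i. oct_sgn (int i)"] m by simp
  also have "\<dots> = 0"
  proof (induction m)
    case (Suc m)
    have "(\<Sum>i<8 * Suc m. f i) = (\<Sum>i<8 * m. f i) + (\<Sum>j<8. f (8 * m + j))" for f :: "nat \<Rightarrow> int"
      by (simp add: eval_nat_numeral)
    then have "(\<Sum>i<8 * Suc m. oct_sgn (int i)) = (\<Sum>j<8. oct_sgn (int (8 * m + j)))"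
      using Suc by simp
    also have "\<dots> = (\<Sum>j<8. oct_sgn (int j))"
      by (intro sum.cong refl oct_sgn_cong) simp
    also have "\<dots> = 0" by (simp add: oct_sgn_def eval_nat_numeral)
    finally show ?case .
  qed simp
  finally show ?thesis .
qed

text \<open>The conditions \<open>tr z = 1\<close> and \<open>tr (u * z) = 1\<close> are two linear
  equations in \<open>z\<close> and \<open>z ^ q\<close>, with determinant nonzero exactly when
  \<open>u\<close> is outside \<open>K\<close>. For \<open>u\<close> in \<open>K\<close> the second
  trace is \<open>u\<close> itself.\<close>

lemma card_ratio_pairs:
  "card {z \<in> H 1 1. u * z \<in> H 1 1} = (if u = 1 then q else if u \<in> K then 0 else 1)"
proof (cases "u \<in> K")
  case True
  have "card (H 1 1) = q" using card_H[of 1 1] K_simps by simp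
  moreover have "{z \<in> H 1 1. u * z \<in> H 1 1} = (if u = 1 then H 1 1 else {})"
    using tr_mult_K[OF True] by (auto simp: H_def)
  ultimately show ?thesis using True by simp
next
  case False
  then have ne: "u \<noteq> u ^ q" "u \<noteq> 1" using K_simps(2) by (auto simp: K_def)
  \<comment> \<open>The solution given by Cramer's rule.\<close>
  define z where "z = (1 - u ^ q) / (u - u ^ q)"
  have zq: "z ^ q = (1 - u) / (u ^ q - u)"
    by (simp add: z_def power_divide frobenius_diff frobenius_frobenius)
  have zq': "z ^ q = (u - 1) / (u - u ^ q)"
    unfolding zq using ne by (simp add: divide_simps) (simp add: algebra_simps)
  have "tr z = 1" unfolding tr_def zq' using ne by (simp add: z_def field_simps flip: add_divide_distrib)
  moreover have "tr (u * z) = 1"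
  proof -
    have "tr (u * z) = (u * (1 - u ^ q) + u ^ q * (u - 1)) / (u - u ^ q)"
      unfolding tr_def power_mult_distrib zq' by (simp add: z_def add_divide_distrib)
    also have "u * (1 - u ^ q) + u ^ q * (u - 1) = u - u ^ q" by (simp add: algebra_simps)
    finally show ?thesis using ne by simp
  qed
  moreover have "x = z" if "tr x = 1" "tr (u * x) = 1" for x
  proof -
    have "x ^ q = 1 - x" using that(1) by (simp add: tr_def eq_diff_eq add.commute)
    then have "u * x + u ^ q * (1 - x) = 1" using that(2) by (simp add: tr_def power_mult_distrib)
    then have "x * (u - u ^ q) = 1 - u ^ q" by (simp add: algebra_simps)
    then show ?thesis using ne by (simp add: z_def field_simps)
  qed
  ultimately have "{x. tr x = 1 \<and> tr (u * x) = 1} = {z}" by blast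
  then have "{z \<in> H 1 1. u * z \<in> H 1 1} = {z}" by (simp add: H_def)
  then show ?thesis using False ne by simp
qed

text \<open>By orthogonality the four squares add up to the sum of \<open>eta\<close> over the
  quotients of elements of trace 1. The quotient 1 occurs \<open>q\<close> times, the rest of
  \<open>K\<close> never and every element outside \<open>K\<close> once, while \<open>eta\<close>
  sums to 0 both over the field and over \<open>K\<close>.\<close>

lemma tau_norm: "(tau 0)\<^sup>2 + 2 * (tau 1)\<^sup>2 = int q"
proof -
  let ?A = "H 1 1"
  have "(tau 0)\<^sup>2 + 2 * (tau 1)\<^sup>2 = tau 0 * tau 0 + tau 1 * tau 1 + tau 2 * tau 2 + tau 3 * tau 3"
    by (simp add: tau_2 tau_3 power2_eq_square)
  also have "\<dots> = (\<Sum>y\<in>?A. \<Sum>z\<in>?A. oct_sgn (ind y) * oct_sgn (ind z)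
      + oct_sgn (ind y - 1) * oct_sgn (ind z - 1) + oct_sgn (ind y - 2) * oct_sgn (ind z - 2)
      + oct_sgn (ind y - 3) * oct_sgn (ind z - 3))"
    by (simp add: tau_def sum_product sum.distrib)
  also have "\<dots> = (\<Sum>y\<in>?A. \<Sum>z\<in>?A. oct_sgn (ind y - ind z))"
    by (simp only: oct_sgn_orthogonal)
  also have "\<dots> = (\<Sum>z\<in>?A. \<Sum>y\<in>?A. oct_sgn (ind y - ind z))" by (rule sum.swap)
  also have "\<dots> = (\<Sum>z\<in>?A. \<Sum>u\<in>UNIV. if u * z \<in> ?A then eta u else 0)"
  proof (rule sum.cong[OF refl])
    fix z assume "z \<in> ?A"
    then have z: "z \<noteq> 0" by (rule H_nonzero)
    have "(\<Sum>u\<in>UNIV. if u * z \<in> ?A then eta u else 0) = (\<Sum>u\<in>{u. u * z \<in> ?A}. eta u)"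
      using sum.inter_restrict[of UNIV eta "{u. u * z \<in> ?A}"] by simp
    also have "\<dots> = (\<Sum>y\<in>?A. oct_sgn (ind y - ind z))"
    proof (rule sum.reindex_bij_witness[of _ "\<lambda>y. y / z" "\<lambda>u. u * z"])
      fix u assume "u \<in> {u. u * z \<in> ?A}"
      then have u: "u \<noteq> 0" using H_nonzero by fastforce
      have "(ind (u * z) - ind z) mod 8 = (ind u + ind z - ind z) mod 8"
        using ind_mult_8[OF u z] by (rule mod_diff_cong) simp
      then have "oct_sgn (ind (u * z) - ind z) = oct_sgn (ind u)" by (intro oct_sgn_cong) simp
      then show "oct_sgn (ind (u * z) - ind z) = eta u" using u by (simp add: eta_def)
    qed (use z in auto)
    finally show "(\<Sum>y\<in>?A. oct_sgn (ind y - ind z)) = (\<Sum>u\<in>UNIV. if u * z \<in> ?A then eta u else 0)" ..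
  qed
  also have "\<dots> = (\<Sum>u\<in>UNIV. \<Sum>z\<in>?A. if u * z \<in> ?A then eta u else 0)" by (rule sum.swap)
  also have "\<dots> = (\<Sum>u\<in>UNIV. int (card {z \<in> ?A. u * z \<in> ?A}) * eta u)"
  proof (intro sum.cong refl)
    fix u
    have "(\<Sum>z\<in>?A. if u * z \<in> ?A then eta u else 0) = (\<Sum>z\<in>{z \<in> ?A. u * z \<in> ?A}. eta u)"
      by (subst sum.inter_filter) auto
    then show "(\<Sum>z\<in>?A. if u * z \<in> ?A then eta u else 0) = int (card {z \<in> ?A. u * z \<in> ?A}) * eta u"
      by simp
  qed
  also have "\<dots> = (\<Sum>u\<in>UNIV. (if u = 1 then int q else 0) + (eta u - (if u \<in> K then eta u else 0)))"
    unfolding card_ratio_pairs using K_simps(2) by (intro sum.cong refl) (auto simp: eta_1)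
  also have "\<dots> = int q"
  proof -
    have "(\<Sum>u\<in>UNIV. if u \<in> K then eta u else 0) = 0"
      using sum.inter_restrict[of UNIV eta K] sum_eta by simp
    then show ?thesis by (simp add: sum.distrib sum_subtractf sum_eta_UNIV)
  qed
  finally show ?thesis .
qed

lemma power_sum:
  assumes "of_nat q = (0::'a)" "e > 0"
  shows "(\<Sum>z\<in>UNIV. (z::'a) ^ e) = (if N dvd e then - 1 else 0)"
proof -
  have "(\<Sum>z\<in>UNIV. (z::'a) ^ e) = (\<Sum>z\<in>UNIV - {0}. z ^ e)"
    by (rule sum.mono_neutral_right) (use assms(2) in auto)
  also have "\<dots> = (\<Sum>z\<in>UNIV - {0}. (g ^ e) ^ lg z)"
    by (intro sum.cong refl) (metis Diff_iff g_power_lg insertI1 mult.commute power_mult)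
  also have "\<dots> = (\<Sum>i<N. (g ^ e) ^ i)" by (rule sum_lg)
  finally have eq: "(\<Sum>z\<in>UNIV. (z::'a) ^ e) = (\<Sum>i<N. (g ^ e) ^ i)" .
  show ?thesis
  proof (cases "N dvd e")
    case True
    then have "g ^ e = 1" using g_power_mod[of e] by simp
    moreover have "of_nat N = (- 1 :: 'a)"
    proof -
      have "of_nat (N + 1) = (of_nat (q * q) :: 'a)"
        using q_ge_3 by (simp add: N_def power2_eq_square)
      then show ?thesis using assms(1) by (simp add: eq_neg_iff_add_eq_0 add.commute)
    qed
    ultimately show ?thesis using eq True by simp
  next
    case False
    then have "g ^ e \<noteq> 1" using lg_g_power[of e] lg_1 by auto
    moreover have "(g ^ e) ^ N = 1" using power_N[of "g ^ e"] g_nonzero by simp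
    ultimately show ?thesis using eq False by (simp add: sum_gp_strict)
  qed
qed

text \<open>If the characteristic divided \<open>tau 0\<close>, it would divide all values of \<open>tau\<close>, and then the
  sum of \<open>z ^ (7 m) * tr z ^ r\<close> with \<open>m = N div 8\<close> would vanish along every fibre of the trace. Expanding the power of the
  trace, that sum reduces to a single binomial coefficient, which is not divisible by \<open>p\<close>.\<close>

lemma not_char_dvd_tau_0:
  assumes p: "prime p" "p = CHAR('a)" and qp: "q = p ^ (2 * j + 1)" and p8: "p mod 8 = 3"
  shows "\<not> int p dvd tau 0"
proof
  assume t0: "int p dvd tau 0"
  have pr: "prime (int p)" using p by simp
  have "int p dvd int q" by (simp add: qp)
  moreover have "2 * (tau 1)\<^sup>2 = int q - tau 0 * tau 0"
    using tau_norm by (simp add: power2_eq_square)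
  ultimately have "int p dvd 2 * (tau 1)\<^sup>2" using t0 by simp
  moreover have "\<not> int p dvd 2"
  proof
    assume "int p dvd 2"
    then have "p \<le> 2" using zdvd_imp_le by fastforce
    then show False using p8 by (cases "p = 2"; cases "p = 1"; simp)
  qed
  ultimately have t1: "int p dvd tau 1" using pr by (metis prime_dvd_mult_iff prime_dvd_power)
  have tau0: "of_int (tau (int k)) = (0::'a)" if "k < 4" for k
  proof -
    have "k \<in> {0, 1, 2, 3}" using that by auto
    then have "int p dvd tau (int k)" using t0 t1 tau_2 tau_3 by auto
    then show ?thesis using p(2) by (simp add: of_int_eq_0_iff_char_dvd)
  qed
  obtain s where s: "q = 8 * s + 3" using q_mod_8 by (metis mult_div_mod_eq)
  \<comment> \<open>Here \<open>m\<close> is \<open>N div 8\<close>, \<open>r\<close> is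
    \<open>(q - 1) div 2\<close> and \<open>s\<close> is \<open>(q - 3) div 8\<close>.\<close>
  define m where "m = 8 * s\<^sup>2 + 6 * s + 1"
  define r where "r = 4 * s + 1"
  have Nm: "N = 8 * m" unfolding N_def m_def unfolding s by (simp add: power2_eq_square algebra_simps)
  have "m > 0" by (simp add: m_def)
  have qz: "of_nat q = (0::'a)" using qp p(2) by simp
  \<comment> \<open>Raising to the power \<open>7 * m\<close> is an octic character with values in
    the field itself. Its exponent is \<open>N - m\<close>, so that the term of the expanded trace
    power with exponent \<open>m\<close> completes it to \<open>N\<close>.\<close>
  define w where "w = g ^ (7 * m)"
  have w4: "w ^ 4 = - 1"
  proof -
    have "(w ^ 4)\<^sup>2 = (g ^ N) ^ 7" by (simp add: w_def Nm mult.commute flip: power_mult)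
    then have "(w ^ 4)\<^sup>2 = 1" using power_N[OF g_nonzero] by simp
    moreover have "w ^ 4 \<noteq> 1"
    proof
      assume "w ^ 4 = 1"
      then have "g ^ (28 * m) = g ^ 0" by (simp add: w_def mult.commute flip: power_mult)
      then have "28 * m mod N = 0" by (metis lg_g_power mod_0)
      then have "8 * m dvd 28 * m" unfolding Nm by (simp add: dvd_eq_mod_eq_0)
      then show False using \<open>m > 0\<close> by simp
    qed
    ultimately show ?thesis unfolding power2_eq_1_iff by blast
  qed
  have fibre1: "(\<Sum>z\<in>H 1 1. z ^ (7 * m)) = 0"
  proof -
    have "(\<Sum>z\<in>H 1 1. z ^ (7 * m)) = (\<Sum>z\<in>H 1 1. w ^ lg z)"
    proof (intro sum.cong refl)
      fix z assume "z \<in> H 1 1"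
      then show "z ^ (7 * m) = w ^ lg z"
        unfolding w_def using g_power_lg[of z] H_nonzero[of z 1] by (metis mult.commute power_mult)
    qed
    also have "\<dots> = (\<Sum>z\<in>H 1 1. \<Sum>k<4. of_int (oct_sgn (ind z - int k)) * w ^ k)"
      unfolding ind_def by (intro sum.cong refl power_eq_sum_oct_sgn w4)
    also have "\<dots> = (\<Sum>k<4. \<Sum>z\<in>H 1 1. of_int (oct_sgn (ind z - int k)) * w ^ k)"
      by (rule sum.swap)
    also have "\<dots> = (\<Sum>k<4. of_int (tau (int k)) * w ^ k)"
      by (simp add: tau_def sum_distrib_right)
    also have "\<dots> = 0" using tau0 by simp
    finally show ?thesis .
  qed
  have "(\<Sum>z\<in>UNIV. z ^ (7 * m) * tr z ^ r) = (\<Sum>t\<in>K. \<Sum>z\<in>H 1 t. z ^ (7 * m) * tr z ^ r)"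
    by (rule sum_H_all[symmetric])
  also have "\<dots> = (\<Sum>t\<in>K. 0)"
  proof (rule sum.cong[OF refl])
    fix t assume t: "t \<in> K"
    have "(\<Sum>z\<in>H 1 t. z ^ (7 * m) * tr z ^ r) = (\<Sum>z\<in>H 1 t. z ^ (7 * m)) * t ^ r"
      unfolding sum_distrib_right by (intro sum.cong refl) (simp add: H_def)
    also have "\<dots> = 0"
    proof (cases "t = 0")
      case True then show ?thesis by (simp add: r_def)
    next
      case False
      then have "(\<Sum>z\<in>H 1 t. z ^ (7 * m)) = t ^ (7 * m) * (\<Sum>z\<in>H 1 1. z ^ (7 * m))"
        using sum_H_scale[OF t False, of "\<lambda>z. z ^ (7 * m)" 1]
        by (simp add: power_mult_distrib sum_distrib_left)
      then show ?thesis using fibre1 by simp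
    qed
    finally show "(\<Sum>z\<in>H 1 t. z ^ (7 * m) * tr z ^ r) = 0" .
  qed
  finally have zero: "(\<Sum>z\<in>UNIV. (z::'a) ^ (7 * m) * tr z ^ r) = 0" by simp
  \<comment> \<open>With \<open>k = r - i\<close> the exponent is
    \<open>N + (q - 1) * (k - s)\<close>, and \<open>k - s\<close> is too small in absolute value to
    be a nonzero multiple of \<open>q + 1\<close>.\<close>
  have dvd: "N dvd (7 * m + i + q * (r - i)) \<longleftrightarrow> r - i = s" if "i \<le> r" for i
  proof -
    define k where "k = r - i"
    have i: "i = r - k" "k \<le> r" using that by (auto simp: k_def)
    have e: "int (7 * m + i + q * (r - i)) = int N + int (8 * s + 2) * (int k - int s)"
      using i(2) unfolding k_def[symmetric] i(1) Nm by (simp add: of_nat_diff m_def r_def s power2_eq_square algebra_simps)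
    have N2: "int N = int (8 * s + 2) * int (8 * s + 4)" unfolding N_eq unfolding s by (simp add: algebra_simps)
    have "N dvd (7 * m + i + q * (r - i)) \<longleftrightarrow> int N dvd int (8 * s + 2) * (int k - int s)"
      unfolding int_dvd_int_iff[symmetric] e by simp
    also have "\<dots> \<longleftrightarrow> int (8 * s + 4) dvd int k - int s"
      unfolding N2 by (rule dvd_times_left_cancel_iff) simp
    also have "\<dots> \<longleftrightarrow> k = s"
    proof
      assume d: "int (8 * s + 4) dvd int k - int s"
      show "k = s"
      proof (rule ccontr)
        assume "k \<noteq> s"
        then have "int (8 * s + 4) \<le> \<bar>int k - int s\<bar>" using dvd_imp_le_int[OF _ d] by simp
        then show False using i(2) by (simp add: r_def)
      qed
    qed simp
    finally show ?thesis by (simp add: k_def)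
  qed
  have "(\<Sum>z\<in>UNIV. (z::'a) ^ (7 * m) * tr z ^ r) =
      (\<Sum>z\<in>UNIV. \<Sum>i\<le>r. of_nat (r choose i) * z ^ (7 * m + i + q * (r - i)))"
    unfolding tr_def binomial_ring sum_distrib_left
    by (intro sum.cong refl) (simp only: power_add power_mult mult_ac)
  also have "\<dots> = (\<Sum>i\<le>r. \<Sum>z\<in>UNIV. of_nat (r choose i) * z ^ (7 * m + i + q * (r - i)))"
    by (rule sum.swap)
  also have "\<dots> = (\<Sum>i\<le>r. of_nat (r choose i) * (\<Sum>z\<in>UNIV. z ^ (7 * m + i + q * (r - i))))"
    by (simp only: sum_distrib_left)
  also have "\<dots> = (\<Sum>i\<le>r. if i = r - s then - of_nat (r choose i) else 0)"
  proof (intro sum.cong refl)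
    fix i assume "i \<in> {..r}"
    then have i: "i \<le> r" by simp
    have "r - i = s \<longleftrightarrow> i = r - s" using i by (auto simp: r_def)
    then show "of_nat (r choose i) * (\<Sum>z\<in>UNIV. (z::'a) ^ (7 * m + i + q * (r - i))) =
        (if i = r - s then - of_nat (r choose i) else 0)"
      using power_sum[OF qz, of "7 * m + i + q * (r - i)"] dvd[OF i] \<open>m > 0\<close> by simp
  qed
  also have "\<dots> = - of_nat (r choose (r - s))" by simp
  finally have "of_nat (r choose (r - s)) = (0::'a)" using zero by simp
  moreover have "r choose (r - s) = r choose s" by (rule binomial_symmetric[symmetric]) (simp add: r_def)
  ultimately have "p dvd (r choose s)" using p(2) by (simp add: of_nat_eq_0_iff_char_dvd)
  moreover have "r = (p ^ (2 * j + 1) - 1) div 2" "s = (p ^ (2 * j + 1) - 3) div 8"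
    unfolding qp[symmetric] by (simp_all add: r_def s)
  ultimately show False using not_prime_dvd_octic_binomial[OF p(1) p8, of j] by simp
qed

end

subsection \<open>Blocks from sign functions\<close>

text \<open>The product of \<open>1 + F (v + u)\<close> and \<open>1 + F v\<close> is 4 if both
  points lie in the block and 0 otherwise.\<close>

lemma diff_count_pm1:
  fixes F :: "'g::ab_group_add \<Rightarrow> int"
  assumes fin: "finite (UNIV :: 'g set)" and pm: "\<And>x. F x = 1 \<or> F x = - 1" and "u \<noteq> 0"
  shows "4 * int (card {(x, y). x \<in> {x. F x = 1} \<and> y \<in> {x. F x = 1} \<and> x \<noteq> y \<and> x - y = u}) =
    int (card (UNIV :: 'g set)) + 2 * (\<Sum>x\<in>UNIV. F x) + corr F F u"
proof -
  have "bij_betw (\<lambda>v. (v + u, v)) {v. F (v + u) = 1 \<and> F v = 1}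
      {(x, y). x \<in> {x. F x = 1} \<and> y \<in> {x. F x = 1} \<and> x \<noteq> y \<and> x - y = u}"
    by (rule bij_betwI[where g = snd]) (use \<open>u \<noteq> 0\<close> in auto)
  then have c: "card {(x, y). x \<in> {x. F x = 1} \<and> y \<in> {x. F x = 1} \<and> x \<noteq> y \<and> x - y = u} =
      card {v. F (v + u) = 1 \<and> F v = 1}" using bij_betw_same_card by fastforce
  have "4 * int (card {v. F (v + u) = 1 \<and> F v = 1}) =
      (\<Sum>v\<in>UNIV. if F (v + u) = 1 \<and> F v = 1 then 4 else 0)"
    using fin by (simp flip: sum.inter_filter)
  also have "\<dots> = (\<Sum>v\<in>UNIV. 1 + F (v + u) + F v + F (v + u) * F v)"
  proof (rule sum.cong[OF refl])
    fix v show "(if F (v + u) = 1 \<and> F v = 1 then 4 else 0) = 1 + F (v + u) + F v + F (v + u) * F v"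
      using pm[of v] pm[of "v + u"] by auto
  qed
  also have "\<dots> = int (card (UNIV :: 'g set)) + 2 * (\<Sum>x\<in>UNIV. F x) + corr F F u"
  proof -
    have "(\<Sum>v\<in>UNIV. F (v + u)) = (\<Sum>v\<in>UNIV. F v)"
      by (rule sum.reindex_bij_witness[of _ "\<lambda>v. v - u" "\<lambda>v. v + u"]) auto
    then show ?thesis by (simp add: sum.distrib corr_def)
  qed
  finally show ?thesis using c by simp
qed

lemma card_pm1:
  fixes F :: "'g \<Rightarrow> int"
  assumes fin: "finite (UNIV :: 'g set)" and pm: "\<And>x. F x = 1 \<or> F x = - 1"
  shows "2 * int (card {x. F x = 1}) = int (card (UNIV :: 'g set)) + (\<Sum>x\<in>UNIV. F x)"
proof -
  have "2 * int (card {x. F x = 1}) = (\<Sum>x\<in>UNIV. if F x = 1 then 2 else 0)"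
    using fin by (simp flip: sum.inter_filter)
  also have "\<dots> = (\<Sum>x\<in>UNIV. 1 + F x)"
  proof (intro sum.cong refl)
    fix x show "(if F x = 1 then 2 else 0) = 1 + F x" using pm[of x] by auto
  qed
  finally show ?thesis by (simp add: sum.distrib)
qed

section \<open>Functions on the product with the group of order 2\<close>

lemma UNIV_bit: "(UNIV :: bit set) = {0, 1}"
  using bit_not_one_iff by auto

definition glue :: "('a \<Rightarrow> int) \<Rightarrow> ('a \<Rightarrow> int) \<Rightarrow> bit \<times> 'a \<Rightarrow> int" where
  "glue f h x = (if fst x = 0 then f (snd x) else h (snd x))"

lemma finite_UNIV_bit_prod: "finite (UNIV :: (bit \<times> 'a::finite) set)"
  by (simp add: UNIV_bit flip: UNIV_Times_UNIV)

lemma card_UNIV_bit_prod: "card (UNIV :: (bit \<times> 'a::finite) set) = 2 * card (UNIV :: 'a set)"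
  by (simp add: UNIV_bit card_cartesian_product flip: UNIV_Times_UNIV)

lemma sum_UNIV_bit_prod:
  fixes F :: "bit \<times> 'a::finite \<Rightarrow> int"
  shows "(\<Sum>x\<in>UNIV. F x) = (\<Sum>y\<in>UNIV. F (0, y)) + (\<Sum>y\<in>UNIV. F (1, y))"
proof -
  have "(\<Sum>x\<in>UNIV. F x) = (\<Sum>b\<in>{0, 1}. \<Sum>y\<in>UNIV. F (b, y))"
    by (simp add: sum.cartesian_product UNIV_bit flip: UNIV_Times_UNIV)
  then show ?thesis by simp
qed

lemma sum_glue:
  "(\<Sum>x\<in>UNIV. glue f h x) = (\<Sum>y\<in>UNIV. f y) + (\<Sum>y\<in>UNIV. h (y::'a::finite))"
  by (simp add: sum_UNIV_bit_prod glue_def)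

lemma corr_glue_0:
  fixes f h :: "'a::{finite,ab_group_add} \<Rightarrow> int"
  shows "corr (glue f h) (glue f h) (0, u) = corr f f u + corr h h u"
  by (simp add: corr_def sum_UNIV_bit_prod glue_def)

lemma corr_glue_1:
  fixes f h :: "'a::{finite,ab_group_add} \<Rightarrow> int"
  shows "corr (glue f h) (glue f h) (1, u) = corr f h u + corr h f u"
  by (simp add: corr_def sum_UNIV_bit_prod glue_def)

text \<open>Adding the four block counts, four times \<open>lam\<close> is \<open>8 * n\<close> plus
  twice the total -2 plus the correlation -4. Differences with first coordinate 0 give
  \<open>c0\<close>, the others give \<open>c1\<close>.\<close>

lemma difference_family_of_pm1:
  fixes f h :: "nat \<Rightarrow> 'a::{finite,ab_group_add} \<Rightarrow> int"
  defines "B \<equiv> \<lambda>i. {x. glue (f i) (h i) x = 1}"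
  assumes n: "card (UNIV :: 'a set) = n"
    and pm: "\<And>i y. i < 4 \<Longrightarrow> f i y = 1 \<or> f i y = - 1" "\<And>i y. i < 4 \<Longrightarrow> h i y = 1 \<or> h i y = - 1"
    and tot: "(\<Sum>i<4. (\<Sum>y\<in>UNIV. f i y) + (\<Sum>y\<in>UNIV. h i y)) = - 2"
    and c0: "\<And>u. u \<noteq> 0 \<Longrightarrow> (\<Sum>i<4. corr (f i) (f i) u + corr (h i) (h i) u) = - 4"
    and c1: "\<And>u. (\<Sum>i<4. corr (f i) (h i) u + corr (h i) (f i) u) = - 4"
  shows "difference_family [B 0, B 1, B 2, B 3] (2 * n - 2)"
  unfolding difference_family_def
proof (intro conjI allI impI)
  let ?Bs = "[B 0, B 1, B 2, B 3]"
  have nth: "?Bs ! i = B i" if "i < 4" for i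
  proof -
    have "i \<in> {0, 1, 2, 3}" using that by auto
    then show ?thesis by auto
  qed
  show "finite (?Bs ! i)" for i
    by (rule finite_subset[OF subset_UNIV finite_UNIV_bit_prod])
  fix x :: "bit \<times> 'a" assume x: "x \<noteq> 0"
  let ?G = "\<lambda>i. glue (f i) (h i)"
  have pmG: "?G i y = 1 \<or> ?G i y = - 1" if "i < 4" for i y
    using pm(1)[OF that] pm(2)[OF that] unfolding glue_def by (cases "fst y = 0") simp_all
  have "4 * int (diff_count ?Bs x) =
    (\<Sum>i<4. 4 * int (card {(y, z). y \<in> B i \<and> z \<in> B i \<and> y \<noteq> z \<and> y - z = x}))"
    unfolding diff_count_def of_nat_sum sum_distrib_left
  proof (rule sum.cong)
    fix i :: nat assume "i \<in> {..<4}"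
    then show "4 * int (card {(y, z). y \<in> ?Bs ! i \<and> z \<in> ?Bs ! i \<and> y \<noteq> z \<and> y - z = x}) =
        4 * int (card {(y, z). y \<in> B i \<and> z \<in> B i \<and> y \<noteq> z \<and> y - z = x})"
      by (simp only: nth lessThan_iff)
  qed simp
  also have "\<dots> = (\<Sum>i<4. 2 * int n + 2 * ((\<Sum>y\<in>UNIV. f i y) + (\<Sum>y\<in>UNIV. h i y)) + corr (?G i) (?G i) x)"
  proof (rule sum.cong[OF refl])
    fix i :: nat assume "i \<in> {..<4}"
    then have "\<And>y. ?G i y = 1 \<or> ?G i y = - 1" using pmG by blast
    from diff_count_pm1[OF finite_UNIV_bit_prod this x] n
    show "4 * int (card {(y, z). y \<in> B i \<and> z \<in> B i \<and> y \<noteq> z \<and> y - z = x}) =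
        2 * int n + 2 * ((\<Sum>y\<in>UNIV. f i y) + (\<Sum>y\<in>UNIV. h i y)) + corr (?G i) (?G i) x"
      unfolding B_def by (simp add: sum_glue card_UNIV_bit_prod)
  qed
  also have "\<dots> = 8 * int n - 4 + (\<Sum>i<4. corr (?G i) (?G i) x)"
    unfolding sum.distrib using tot by (simp add: sum.distrib flip: sum_distrib_left)
  also have "(\<Sum>i<4. corr (?G i) (?G i) x) = - 4"
  proof -
    obtain b u where bu: "x = (b, u)" by (cases x)
    show ?thesis
    proof (cases "b = 0")
      case True
      then have "u \<noteq> 0" using x bu by (auto simp: zero_prod_def)
      then show ?thesis unfolding bu True corr_glue_0 by (rule c0)
    next
      case False
      then have "b = 1" by simp
      then show ?thesis unfolding bu by (simp only: corr_glue_1 c1)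
    qed
  qed
  finally have "int (diff_count ?Bs x) = 2 * int n - 2" by simp
  then show "diff_count ?Bs x = 2 * n - 2" by linarith
qed

subsection \<open>The construction\<close>

context quadratic_extension
begin

text \<open>The signs 1, \<open>s\<close>, -1 on three consecutive pairs of opposite classes make
  \<open>omega s 1\<close> vanish, so that the products in \<open>omega_square_sum\<close> reduce to
  the square of \<open>tau 0 + s * tau 1\<close>.\<close>

definition odd_part :: "int \<Rightarrow> int \<Rightarrow> 'a \<Rightarrow> int" where
  "odd_part s h y = (if y = 0 then 0
     else oct_sgn (ind y - h) + s * oct_sgn (ind y - (h + 1)) - oct_sgn (ind y - (h + 2)))"

text \<open>The class \<open>h + 3\<close> modulo 4 contains an odd number \<open>(q + 1) div 4\<close> of lines, indexed by \<open>lg\<close>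
  modulo \<open>q + 1\<close>; one more of them gets the sign \<open>-1\<close> than \<open>1\<close>. Which ones is immaterial.\<close>

definition even_part :: "int \<Rightarrow> 'a \<Rightarrow> int" where
  "even_part h y = (if y = 0 \<or> ind y mod 4 \<noteq> (h + 3) mod 4 then 0
     else if lg y mod (q + 1) div 4 < (q - 3) div 8 then 1 else - 1)"

text \<open>Taking the classes 0 and 1 together matches the sign pattern in
  \<open>omega_square_sum\<close>; compare \<open>paley_part_normal\<close>.\<close>

definition paley_part :: "'a \<Rightarrow> int" where
  "paley_part y = (if y = 0 then 0 else if ind y mod 4 < 2 then 1 else - 1)"

text \<open>The value -1 at 0 equals the mean line value of \<open>even_part\<close> in
  \<open>sum_even_part\<close>, so that no constant is left in the function \<open>r\<close> of
  \<open>projects_phi\<close>.\<close>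

definition phi :: "int \<Rightarrow> int \<Rightarrow> 'a \<Rightarrow> int" where
  "phi s h y = (if y = 0 then - 1 else 0) + even_part h y + odd_part s h y"

text \<open>The last summand is a zero odd part, which gives the shape expected by
  \<open>projects_even_odd\<close>.\<close>

definition rho :: "int \<Rightarrow> 'a \<Rightarrow> int" where
  "rho c y = (if y = 0 then c else 0) + paley_part y + 0"

definition omega :: "int \<Rightarrow> int \<Rightarrow> int" where
  "omega s k = tau k + s * tau (k + 1) - tau (k + 2)"

section \<open>Invariance under scalars and totals\<close>

lemma four_dvd_N: "4 dvd N"
  using eight_dvd_N by (rule dvd_trans[rotated]) simp

lemma ind_mult_4: "x \<noteq> 0 \<Longrightarrow> y \<noteq> 0 \<Longrightarrow> ind (x * y) mod 4 = (ind x + ind y) mod 4"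
  using ind_mult[OF _ _ four_dvd_N] by simp

lemma ind_K_mult_mod_4: "k \<in> K \<Longrightarrow> k \<noteq> 0 \<Longrightarrow> y \<noteq> 0 \<Longrightarrow> ind (k * y) mod 4 = ind y mod 4"
  using ind_mult_4[of k y] ind_K_mod_4[of k] by (metis add_0 mod_add_left_eq)

lemma lg_K_mult_mod: 
  assumes "k \<in> K" "k \<noteq> 0" "y \<noteq> 0"
  shows "lg (k * y) mod (q + 1) = lg y mod (q + 1)"
proof -
  have "lg (k * y) mod (q + 1) = (lg k + lg y) mod (q + 1)"
    unfolding lg_mult[OF assms(2,3)] by (rule mod_mod_cancel) (simp only: N_eq dvd_triv_right)
  also have "\<dots> = lg y mod (q + 1)"
    using K_iff_lg[OF assms(2)] assms(1) by (metis add_0 dvd_imp_mod_0 mod_add_left_eq)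
  finally show ?thesis .
qed

lemma even_part_mult: "k \<in> K \<Longrightarrow> k \<noteq> 0 \<Longrightarrow> even_part h (k * y) = even_part h y"
  by (cases "y = 0") (simp_all add: even_part_def ind_K_mult_mod_4 lg_K_mult_mod del: add_Suc_right One_nat_def add_Suc)

lemma paley_part_mult: "k \<in> K \<Longrightarrow> k \<noteq> 0 \<Longrightarrow> paley_part (k * y) = paley_part y"
  by (simp add: paley_part_def ind_K_mult_mod_4)

lemma odd_part_mult: "k \<in> K \<Longrightarrow> odd_part s h (k * y) = eta k * odd_part s h y"
  by (cases "k = 0 \<or> y = 0")
    (auto simp: odd_part_def oct_sgn_ind_mult distrib_left right_diff_distrib mult.left_commute)

lemma sum_even_part: "(\<Sum>y\<in>UNIV. even_part h y) = int (q - 1) * (- 1)"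
proof -
  obtain m where m: "q = 8 * m + 3" using q_mod_8 by (metis mult_div_mod_eq)
  define r where "r = nat ((h + 3) mod 4)"
  have r: "int r = (h + 3) mod 4" "r < 4" by (simp_all add: r_def nat_less_iff)
  define F :: "nat \<Rightarrow> int" where "F v = (if v mod 4 \<noteq> r then 0 else if v div 4 < m then 1 else - 1)" for v
  have q1: "q + 1 = 4 * (2 * m + 1)" by (simp add: m)
  have "(\<Sum>y\<in>UNIV. even_part h y) = (\<Sum>y\<in>UNIV - {0}. even_part h y)"
    by (rule sum.mono_neutral_right) (auto simp: even_part_def)
  also have "\<dots> = (\<Sum>y\<in>UNIV - {0}. F (lg y mod (q + 1)))"
  proof (rule sum.cong[OF refl])
    fix y assume "y \<in> UNIV - {0::'a}"
    moreover have "lg y mod (q + 1) mod 4 = lg y mod 4" unfolding q1 by (simp add: mod_mod_cancel)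
    moreover have "ind y mod 4 = (h + 3) mod 4 \<longleftrightarrow> lg y mod 4 = r"
      unfolding ind_def r(1)[symmetric] by (metis of_nat_eq_iff of_nat_mod of_nat_numeral)
    moreover have "(q - 3) div 8 = m" by (simp add: m)
    ultimately show "even_part h y = F (lg y mod (q + 1))" by (simp only: even_part_def F_def) simp
  qed
  also have "\<dots> = (\<Sum>i<N. F (i mod (q + 1)))" by (rule sum_lg)
  also have "\<dots> = int (q - 1) * (\<Sum>v<q + 1. F v)" unfolding N_eq by (rule sum_mod_period)
  also have "(\<Sum>v<q + 1. F v) = - 1"
  proof -
    \<comment> \<open>Each run of four residues contains one of class \<open>r\<close>. Among the
      first \<open>l\<close> of these, \<open>min l m\<close> have sign 1 and the others -1; for
      \<open>l = 2 * m + 1\<close> the negative sign wins by one.\<close>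
    have "(\<Sum>v<4 * l. F v) = int (min l m) - int (l - m)" for l
    proof (induction l)
      case (Suc l)
      have e1: "(\<Sum>v<4 * Suc l. F v) = (\<Sum>v<4 * l. F v) + F (4 * l) + F (4 * l + 1) + F (4 * l + 2) + F (4 * l + 3)"
        by (simp add: eval_nat_numeral)
      have e2: "F (4 * l) + F (4 * l + 1) + F (4 * l + 2) + F (4 * l + 3) = (if l < m then 1 else - 1)"
      proof -
        have "r \<in> {0, 1, 2, 3}" using r(2) by auto
        moreover have "F (4 * l + j) = (if j \<noteq> r then 0 else if l < m then 1 else - 1)" if "j < 4" for j
          using that by (simp add: F_def)
        from this[of 0] this[of 1] this[of 2] this[of 3] calculation show ?thesis
          by (elim insertE emptyE) simp_all
      qed
      have "int (min (Suc l) m) - int (Suc l - m) = int (min l m) - int (l - m) + (if l < m then 1 else - 1)"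
        by auto
      then show ?case using Suc e1 e2 by linarith
    qed simp
    from this[of "2 * m + 1"] show ?thesis unfolding q1 by simp
  qed
  finally show ?thesis .
qed

lemma sum_paley_part: "(\<Sum>y\<in>UNIV. paley_part y) = 0"
proof -
  obtain m where m: "N = 4 * m" using four_dvd_N by blast
  define F :: "nat \<Rightarrow> int" where "F v = (if v < 2 then 1 else - 1)" for v
  have "(\<Sum>y\<in>UNIV. paley_part y) = (\<Sum>y\<in>UNIV - {0}. paley_part y)"
    by (rule sum.mono_neutral_right) (auto simp: paley_part_def)
  also have "\<dots> = (\<Sum>y\<in>UNIV - {0}. F (lg y mod 4))"
  proof (rule sum.cong[OF refl])
    fix y assume "y \<in> UNIV - {0::'a}"
    moreover have "ind y mod 4 < 2 \<longleftrightarrow> lg y mod 4 < 2"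
      unfolding ind_def by (metis of_nat_less_iff of_nat_mod of_nat_numeral)
    ultimately show "paley_part y = F (lg y mod 4)" by (simp add: paley_part_def F_def)
  qed
  also have "\<dots> = (\<Sum>i<m * 4. F (i mod 4))" 
    using sum_lg[of "\<lambda>i. F (i mod 4)"] m by (simp add: mult.commute)
  also have "\<dots> = int m * (\<Sum>v<4. F v)" by (rule sum_mod_period)
  also have "(\<Sum>v<4. F v) = 0" unfolding sum_lessThan_4 by (simp add: F_def)
  finally show ?thesis by simp
qed

section \<open>Line sums of the components\<close>

text \<open>Multiplication by \<open>d\<close> carries the line to the elements of trace 1 and adds
  \<open>ind d\<close> to every index.\<close>

lemma proj_oct_sgn:
  assumes "d \<noteq> 0" shows "(\<Sum>y\<in>H d 1. oct_sgn (ind y - k)) = tau (ind d + k)"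
  unfolding tau_def
proof (rule sum.reindex_bij_witness[of _ "\<lambda>z. z / d" "\<lambda>y. d * y"])
  fix y assume "y \<in> H d 1"
  then have "y \<noteq> 0" by (rule H_nonzero)
  then have "(ind (d * y) - (ind d + k)) mod 8 = (ind d + ind y - (ind d + k)) mod 8"
    using ind_mult_8[OF assms] by (intro mod_diff_cong) simp_all
  then show "oct_sgn (ind (d * y) - (ind d + k)) = oct_sgn (ind y - k)"
    by (intro oct_sgn_cong) simp
qed (use assms in \<open>auto simp: H_def\<close>)

lemma proj_odd_part:
  assumes "d \<noteq> 0" shows "proj (odd_part s h) d 1 = omega s (ind d + h)"
proof -
  have "proj (odd_part s h) d 1 = (\<Sum>y\<in>H d 1. oct_sgn (ind y - h) + s * oct_sgn (ind y - (h + 1)) - oct_sgn (ind y - (h + 2)))"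
    unfolding proj_def by (intro sum.cong refl) (use H_nonzero in \<open>auto simp: odd_part_def\<close>)
  also have "\<dots> = tau (ind d + h) + s * tau (ind d + (h + 1)) - tau (ind d + (h + 2))"
    by (simp only: sum.distrib sum_subtractf sum_distrib_left[symmetric] proj_oct_sgn[OF assms])
  finally show ?thesis by (simp add: omega_def add.assoc)
qed

lemma projects_phi:
  "projects (phi s h) (\<lambda>d. int q * even_part h (y0 / d)) (\<lambda>d. - 1 - even_part h (y0 / d)) (\<lambda>d. omega s (ind d + h))"
proof -
  have "projects (phi s h) (\<lambda>d. - 1 - - 1 + int q * even_part h (y0 / d)) (\<lambda>d. - 1 - even_part h (y0 / d))
      (\<lambda>d. proj (odd_part s h) d 1)"
    by (rule projects_even_odd[OF even_part_mult _ odd_part_mult sum_even_part phi_def])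
      (simp_all add: even_part_def)
  then show ?thesis unfolding projects_def by (simp add: proj_odd_part)
qed

lemma projects_rho:
  "projects (rho c) (\<lambda>d. c + int q * paley_part (y0 / d)) (\<lambda>d. - paley_part (y0 / d)) (\<lambda>d. 0)"
proof -
  have "projects (rho c) (\<lambda>d. c - 0 + int q * paley_part (y0 / d)) (\<lambda>d. 0 - paley_part (y0 / d)) (\<lambda>d. proj (\<lambda>_. 0) d 1)"
    by (rule projects_even_odd[OF paley_part_mult])
      (simp_all add: paley_part_def rho_def sum_paley_part[unfolded paley_part_def])
  then show ?thesis by (simp add: proj_def)
qed

lemma sum_phi: "(\<Sum>y\<in>UNIV. phi s h y) = - int q"
  using projects_total[OF projects_phi, of 1 s h] by (simp add: algebra_simps)

lemma sum_rho: "(\<Sum>y\<in>UNIV. rho c y) = c"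
  using projects_total[OF projects_rho, of 1 c] by simp

lemma rho_pm1: "c = 1 \<or> c = - 1 \<Longrightarrow> rho c y = 1 \<or> rho c y = - 1"
  by (auto simp: rho_def paley_part_def)

text \<open>Away from 0, exactly one summand is nonzero: the odd part covers the classes
  \<open>h\<close>, \<open>h + 1\<close>, \<open>h + 2\<close> modulo 4 and the even part covers
  \<open>h + 3\<close>.\<close>

lemma phi_pm1:
  assumes "s = 1 \<or> s = - 1" shows "phi s h y = 1 \<or> phi s h y = - 1"
proof (cases "y = 0")
  case False
  define x where "x = (ind y - h) mod 8"
  have oct: "oct_sgn (ind y - (h + j)) = oct_sgn (x - j)" for j
    by (rule oct_sgn_cong) (simp add: x_def mod_diff_left_eq diff_diff_eq[symmetric])
  have "ind y mod 4 = (h + 3) mod 4 \<longleftrightarrow> (ind y - h) mod 4 = 3"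
    by presburger
  also have "(ind y - h) mod 4 = x mod 4" by (simp add: x_def mod_mod_cancel)
  finally have ev: "even_part h y = (if x mod 4 = 3 then if lg y mod (q + 1) div 4 < (q - 3) div 8 then 1 else - 1 else 0)"
    using False by (simp add: even_part_def)
  have od: "odd_part s h y = oct_sgn x + s * oct_sgn (x - 1) - oct_sgn (x - 2)"
    using False oct[of 0] by (simp add: odd_part_def oct)
  have "x \<in> {0, 1, 2, 3, 4, 5, 6, 7}" unfolding x_def by (rule mod_8_cases)
  then show ?thesis using assms False unfolding phi_def ev od
    by (elim insertE emptyE) (auto simp: oct_sgn_def)
qed (simp add: phi_def even_part_def odd_part_def)


section \<open>Norm and cross identities\<close>

lemma omega_values:
  assumes "s = 1 \<or> s = - 1"
  shows "omega s (k + 4) = - omega s k"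
    and "omega s 0 = tau 0 + s * tau 1" "omega s 1 = 0" "omega s 2 = tau 0 + s * tau 1"
    and "omega s 3 = 2 * tau 1 - s * tau 0"
proof -
  have t: "tau 4 = - tau 0" "tau 5 = - tau 1" using tau_add_4[of 0] tau_add_4[of 1] by simp_all
  show "omega s (k + 4) = - omega s k"
    using tau_add_4[of k] tau_add_4[of "k + 1"] tau_add_4[of "k + 2"]
    by (simp add: omega_def algebra_simps)
  show "omega s 0 = tau 0 + s * tau 1" "omega s 1 = 0" "omega s 2 = tau 0 + s * tau 1"
    "omega s 3 = 2 * tau 1 - s * tau 0"
    by (simp_all add: omega_def tau_2 tau_3 t)
qed

lemma omega_cong: "k mod 8 = l mod 8 \<Longrightarrow> omega s k = omega s l"
  unfolding omega_def by (simp add: tau_cong[of k l] tau_cong[of "k + 1" "l + 1"] tau_cong[of "k + 2" "l + 2"] mod_add_cong)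

text \<open>Over four consecutive indices \<open>omega\<close> takes, up to order and signs, the
  values \<open>a\<close>, 0, \<open>a\<close>, \<open>b\<close>, and \<open>2 * a^2 + b^2\<close>
  is three times the norm in \<open>tau_norm\<close>. In the mixed sum the product with odd indices
  is 0, and the other is \<open>a^2\<close> up to a sign depending on \<open>k\<close> modulo
  4.\<close>

lemma omega_square_sum:
  assumes s: "s = 1 \<or> s = - 1"
  shows "(omega s k)\<^sup>2 + (omega s (k + 1))\<^sup>2 + (omega s (k + 2))\<^sup>2 + (omega s (k + 3))\<^sup>2 = 3 * int q"
    and "omega s k * omega s (k + 2) + omega s (k + 1) * omega s (k + 3) =
      (if k mod 4 = 0 \<or> k mod 4 = 3 then 1 else - 1) * (tau 0 + s * tau 1)\<^sup>2"
proof -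
  define a where "a = tau 0 + s * tau 1"
  define b where "b = 2 * tau 1 - s * tau 0"
  have w: "omega s 0 = a" "omega s 1 = 0" "omega s 2 = a" "omega s 3 = b"
    "omega s 4 = - a" "omega s 5 = 0" "omega s 6 = - a" "omega s 7 = - b"
    "omega s 8 = a" "omega s 9 = 0" "omega s 10 = a"
    using omega_values[OF s] omega_values(1)[OF s, of 0] omega_values(1)[OF s, of 1]
      omega_values(1)[OF s, of 2] omega_values(1)[OF s, of 3] omega_values(1)[OF s, of 4]
      omega_values(1)[OF s, of 5] omega_values(1)[OF s, of 6]
    by (simp_all add: a_def b_def)
  have ab: "2 * a\<^sup>2 + b\<^sup>2 = 3 * int q"
  proof -
    have "2 * a\<^sup>2 + b\<^sup>2 = 3 * ((tau 0)\<^sup>2 + 2 * (tau 1)\<^sup>2)"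
      using s by (auto simp: a_def b_def power2_eq_square algebra_simps)
    then show ?thesis using tau_norm by simp
  qed
  define x where "x = k mod 8"
  have red: "omega s (k + j) = omega s (x + j)" for j
    by (rule omega_cong) (simp add: x_def mod_add_left_eq)
  have red0: "omega s k = omega s x" using red[of 0] by simp
  have k4: "k mod 4 = x mod 4" by (simp add: x_def mod_mod_cancel)
  have x: "x \<in> {0, 1, 2, 3, 4, 5, 6, 7}" unfolding x_def by (rule mod_8_cases)
  show "(omega s k)\<^sup>2 + (omega s (k + 1))\<^sup>2 + (omega s (k + 2))\<^sup>2 + (omega s (k + 3))\<^sup>2 = 3 * int q"
    using x ab unfolding red red0 by (elim insertE emptyE) (simp_all add: w)
  show "omega s k * omega s (k + 2) + omega s (k + 1) * omega s (k + 3) =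
      (if k mod 4 = 0 \<or> k mod 4 = 3 then 1 else - 1) * (tau 0 + s * tau 1)\<^sup>2"
    using x unfolding red red0 k4 a_def[symmetric]
    by (elim insertE emptyE) (simp_all add: w power2_eq_square)
qed

lemma even_part_squares:
  assumes "y \<noteq> 0"
  shows "(even_part 0 y)\<^sup>2 + (even_part 1 y)\<^sup>2 + (even_part 2 y)\<^sup>2 + (even_part 3 y)\<^sup>2 = 1"
    and "even_part 0 y * even_part 2 y = 0" "even_part 1 y * even_part 3 y = 0"
proof -
  define e :: int where "e = (if lg y mod (q + 1) div 4 < (q - 3) div 8 then 1 else - 1)"
  have e: "e\<^sup>2 = 1" by (simp add: e_def)
  have ev: "even_part h y = (if ind y mod 4 = (h + 3) mod 4 then e else 0)" for h
    using assms by (simp add: even_part_def e_def)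
  have "ind y mod 4 \<in> {0, 1, 2, 3}" by auto
  then show "(even_part 0 y)\<^sup>2 + (even_part 1 y)\<^sup>2 + (even_part 2 y)\<^sup>2 + (even_part 3 y)\<^sup>2 = 1"
    unfolding ev using e by (elim insertE emptyE) simp_all
  show "even_part 0 y * even_part 2 y = 0" "even_part 1 y * even_part 3 y = 0"
    unfolding ev by auto
qed

text \<open>The indices of \<open>d\<close> and \<open>y0 / d\<close> add up to 2 modulo 4. The
  resulting sign is opposite to the one in \<open>omega_square_sum\<close>.\<close>

lemma paley_part_normal:
  assumes "d \<noteq> 0"
  shows "paley_part (y0 / d) = (if ind d mod 4 = 0 \<or> ind d mod 4 = 3 then - 1 else 1)"
proof -
  have nz: "y0 / d \<noteq> 0" using assms y0_nonzero by simp
  have "(ind (y0 / d) + ind d) mod 4 = 2"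
    using ind_mult_4[OF nz assms] assms ind_y0 by simp
  then have "ind (y0 / d) mod 4 < 2 \<longleftrightarrow> \<not> (ind d mod 4 = 0 \<or> ind d mod 4 = 3)" by presburger
  then show ?thesis using nz by (simp add: paley_part_def)
qed

text \<open>\<open>fam s i\<close> and \<open>fam s (i + 4)\<close> are the two components of block \<open>i < 4\<close>.\<close>

definition fam :: "int \<Rightarrow> nat \<Rightarrow> 'a \<Rightarrow> int" where
  "fam s i = [phi s 0, phi s 1, rho 1, rho (-1),
     \<lambda>y. - phi s 2 y, \<lambda>y. - phi s 3 y, \<lambda>y. - rho 1 y, rho (-1)] ! i"

definition fam_r :: "nat \<Rightarrow> 'a \<Rightarrow> int" where
  "fam_r i d = [int q * even_part 0 (y0 / d), int q * even_part 1 (y0 / d),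
     1 + int q * paley_part (y0 / d), - 1 + int q * paley_part (y0 / d),
     - (int q * even_part 2 (y0 / d)), - (int q * even_part 3 (y0 / d)),
     - (1 + int q * paley_part (y0 / d)), - 1 + int q * paley_part (y0 / d)] ! i"

definition fam_m :: "nat \<Rightarrow> 'a \<Rightarrow> int" where
  "fam_m i d = [- 1 - even_part 0 (y0 / d), - 1 - even_part 1 (y0 / d),
     - paley_part (y0 / d), - paley_part (y0 / d),
     - (- 1 - even_part 2 (y0 / d)), - (- 1 - even_part 3 (y0 / d)),
     - (- paley_part (y0 / d)), - paley_part (y0 / d)] ! i"

definition fam_T :: "int \<Rightarrow> nat \<Rightarrow> 'a \<Rightarrow> int" where
  "fam_T s i d = [omega s (ind d + 0), omega s (ind d + 1), 0, 0,
     - omega s (ind d + 2), - omega s (ind d + 3), - 0, 0] ! i"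

lemma projects_fam:
  assumes "i < 8" shows "projects (fam s i) (fam_r i) (fam_m i) (fam_T s i)"
  using less_8_cases[OF assms] projects_phi[of s 0] projects_phi[of s 1] projects_rho[of 1]
    projects_rho[of "- 1"] projects_uminus[OF projects_phi[of s 2]]
    projects_uminus[OF projects_phi[of s 3]] projects_uminus[OF projects_rho[of 1]]
  by (elim insertE emptyE) (simp_all add: fam_def fam_r_def[abs_def] fam_m_def[abs_def] fam_T_def[abs_def])

lemma sum_fam:
  assumes "i < 8"
  shows "(\<Sum>y\<in>UNIV. fam s i y) = [- int q, - int q, 1, - 1, int q, int q, - 1, - 1] ! i"
  using less_8_cases[OF assms]
  by (elim insertE emptyE) (simp_all add: fam_def sum_negf sum_phi sum_rho)

lemma fam_pm1:
  assumes "s = 1 \<or> s = - 1" "i < 8" shows "fam s i y = 1 \<or> fam s i y = - 1"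
  using less_8_cases[OF assms(2)] phi_pm1[OF assms(1), of 0 y] phi_pm1[OF assms(1), of 1 y]
    phi_pm1[OF assms(1), of 2 y] phi_pm1[OF assms(1), of 3 y] rho_pm1[of 1 y] rho_pm1[of "- 1" y]
  by (elim insertE emptyE) (auto simp: fam_def)

lemma fam_norm:
  assumes s: "s = 1 \<or> s = - 1" and d: "d \<noteq> 0"
  shows "(\<Sum>i<8. fam_r i d * fam_r i d + int q * (fam_T s i d * fam_T s i d)) = 8 * (int q)\<^sup>2 + 4"
proof -
  have nz: "y0 / d \<noteq> 0" using d y0_nonzero by simp
  define E where "E h = even_part h (y0 / d)" for h
  define W where "W h = omega s (ind d + h)" for h
  define P where "P = paley_part (y0 / d)"
  have E2: "(E 0)\<^sup>2 + (E 1)\<^sup>2 + (E 2)\<^sup>2 + (E 3)\<^sup>2 = 1"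
    unfolding E_def by (rule even_part_squares[OF nz])
  have W2: "(W 0)\<^sup>2 + (W 1)\<^sup>2 + (W 2)\<^sup>2 + (W 3)\<^sup>2 = 3 * int q"
    using omega_square_sum(1)[OF s, of "ind d"] by (simp add: W_def)
  have P2: "P\<^sup>2 = 1" by (simp add: P_def paley_part_normal[OF d])
  have r: "fam_r 0 d = int q * E 0" "fam_r 1 d = int q * E 1" "fam_r 2 d = 1 + int q * P"
      "fam_r 3 d = - 1 + int q * P" "fam_r 4 d = - (int q * E 2)" "fam_r 5 d = - (int q * E 3)"
      "fam_r 6 d = - (1 + int q * P)" "fam_r 7 d = - 1 + int q * P"
    by (simp_all add: fam_r_def E_def P_def)
  have T: "fam_T s 0 d = W 0" "fam_T s 1 d = W 1" "fam_T s 2 d = 0" "fam_T s 3 d = 0"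
      "fam_T s 4 d = - W 2" "fam_T s 5 d = - W 3" "fam_T s 6 d = 0" "fam_T s 7 d = 0"
    by (simp_all add: fam_T_def W_def)
  \<comment> \<open>The even parts contribute \<open>q^2\<close>, the octic line sums
    \<open>3 * q^2\<close>, and the Paley components \<open>4 * q^2 + 4\<close>, their linear terms
    cancelling because \<open>rho\<close> is used with both values at 0.\<close>
  have "(\<Sum>i<8. fam_r i d * fam_r i d + int q * (fam_T s i d * fam_T s i d)) =
    (int q)\<^sup>2 * ((E 0)\<^sup>2 + (E 1)\<^sup>2 + (E 2)\<^sup>2 + (E 3)\<^sup>2)
    + int q * ((W 0)\<^sup>2 + (W 1)\<^sup>2 + (W 2)\<^sup>2 + (W 3)\<^sup>2) + 4 + 4 * (int q)\<^sup>2 * P\<^sup>2"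
    unfolding sum_lessThan_8 r T by (simp add: power2_eq_square algebra_simps)
  then show ?thesis unfolding E2 W2 P2 by (simp add: power2_eq_square)
qed

lemma fam_cross:
  assumes s: "s = 1 \<or> s = - 1" and d: "d \<noteq> 0" and t: "(tau 0 + s * tau 1)\<^sup>2 = 4"
  shows "(\<Sum>i<4. fam_r i d * fam_r (i + 4) d + int q * (fam_T s i d * fam_T s (i + 4) d)) = 0"
proof -
  have nz: "y0 / d \<noteq> 0" using d y0_nonzero by simp
  define E where "E h = even_part h (y0 / d)" for h
  define W where "W h = omega s (ind d + h)" for h
  define P where "P = paley_part (y0 / d)"
  have E0: "E 0 * E 2 = 0" "E 1 * E 3 = 0"
    unfolding E_def by (rule even_part_squares[OF nz])+
  have W0: "W 0 * W 2 + W 1 * W 3 = - 4 * P"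
  proof -
    have "W 0 * W 2 + W 1 * W 3 = (if ind d mod 4 = 0 \<or> ind d mod 4 = 3 then 1 else - 1) * 4"
      using omega_square_sum(2)[OF s, of "ind d"] unfolding t W_def add_0_right .
    also have "\<dots> = - 4 * P" unfolding P_def paley_part_normal[OF d] by (simp only: split: if_splits) simp
    finally show ?thesis .
  qed
  have r: "fam_r 0 d = int q * E 0" "fam_r 1 d = int q * E 1" "fam_r 2 d = 1 + int q * P"
      "fam_r 3 d = - 1 + int q * P" "fam_r 4 d = - (int q * E 2)" "fam_r 5 d = - (int q * E 3)"
      "fam_r 6 d = - (1 + int q * P)" "fam_r 7 d = - 1 + int q * P"
    by (simp_all add: fam_r_def E_def P_def)
  have T: "fam_T s 0 d = W 0" "fam_T s 1 d = W 1" "fam_T s 2 d = 0" "fam_T s 3 d = 0"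
      "fam_T s 4 d = - W 2" "fam_T s 5 d = - W 3" "fam_T s 6 d = 0" "fam_T s 7 d = 0"
    by (simp_all add: fam_T_def W_def)
  \<comment> \<open>The even parts paired in one block have disjoint supports. What remains is
    \<open>4 * q * P\<close> from the octic blocks, by the hypothesis on \<open>tau\<close>, against
    \<open>- 4 * q * P\<close> from the Paley blocks.\<close>
  have "(\<Sum>i<4. fam_r i d * fam_r (i + 4) d + int q * (fam_T s i d * fam_T s (i + 4) d)) =
    - (int q)\<^sup>2 * (E 0 * E 2) - (int q)\<^sup>2 * (E 1 * E 3) - int q * (W 0 * W 2 + W 1 * W 3) - 4 * int q * P"
    unfolding sum_lessThan_4 by (simp add: r[simplified] T[simplified] power2_eq_square algebra_simps)
  then show ?thesis unfolding E0 W0 by simp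
qed

lemma ex_difference_family:
  assumes s: "s = 1 \<or> s = - 1" and t: "(tau 0 + s * tau 1)\<^sup>2 = 4"
  shows "\<exists>B1 B2 B3 B4 :: (bit \<times> 'a) set.
    card B1 = q\<^sup>2 \<and> card B2 = q\<^sup>2 \<and> card B3 = q\<^sup>2 \<and> card B4 = q\<^sup>2 - 1 \<and>
    difference_family [B1, B2, B3, B4] (2 * q\<^sup>2 - 2)"
proof -
  let ?f = "\<lambda>i. fam s i" and ?h = "\<lambda>i. fam s (i + 4)"
  define B where "B i = {x. glue (?f i) (?h i) x = 1}" for i
  have c0: "(\<Sum>i<4. corr (?f i) (?f i) u + corr (?h i) (?h i) u) = - 4" if "u \<noteq> 0" for u
  proof -
    \<comment> \<open>The symmetric statement is used with both functions equal, over all eight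
      components, so every autocorrelation appears twice.\<close>
    have "(\<Sum>i<8. corr (?f i) (?f i) u + corr (?f i) (?f i) u) =
        (if u = 0 then 2 * (8 * (int q)\<^sup>2 + 4) else 0) + 2 * (- 4)"
    proof (rule sum_corr_eq)
      show "(\<Sum>i<8. (\<Sum>y\<in>UNIV. fam s i y) * (\<Sum>y\<in>UNIV. fam s i y)) = 8 * (int q)\<^sup>2 + 4 + int (q\<^sup>2) * - 4"
        by (simp add: sum_lessThan_8 sum_fam power2_eq_square)
    qed (use projects_fam fam_norm[OF s] in auto)
    then show ?thesis using that by (simp add: sum_lessThan_8 sum_lessThan_4)
  qed
  have c1: "(\<Sum>i<4. corr (?f i) (?h i) u + corr (?h i) (?f i) u) = - 4" for u
  proof -
    have "(\<Sum>i<4. corr (?f i) (?h i) u + corr (?h i) (?f i) u) = (if u = 0 then 2 * 0 else 0) + 2 * (- 2)"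
    proof (rule sum_corr_eq)
      show "(\<Sum>i<4. (\<Sum>y\<in>UNIV. fam s i y) * (\<Sum>y\<in>UNIV. fam s (i + 4) y)) = 0 + int (q\<^sup>2) * - 2"
        by (simp add: sum_lessThan_4 sum_fam power2_eq_square)
    next
      fix i :: nat assume "i \<in> {..<4}"
      then show "projects (fam s i) (fam_r i) (fam_m i) (fam_T s i)"
        "projects (fam s (i + 4)) (fam_r (i + 4)) (fam_m (i + 4)) (fam_T s (i + 4))"
        by (auto intro!: projects_fam)
    qed (use fam_cross[OF s _ t] in auto)
    then show ?thesis by simp
  qed
  have tot: "(\<Sum>i<4. (\<Sum>y\<in>UNIV. ?f i y) + (\<Sum>y\<in>UNIV. ?h i y)) = - 2"
    by (simp add: sum_lessThan_4 sum_fam)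
  have pm: "?f i y = 1 \<or> ?f i y = - 1" "?h i y = 1 \<or> ?h i y = - 1" if "i < 4" for i y
    using fam_pm1[OF s] that by auto
  have "difference_family [B 0, B 1, B 2, B 3] (2 * q\<^sup>2 - 2)"
    unfolding B_def by (rule difference_family_of_pm1[OF card_field pm tot c0 c1])
  moreover have cardB: "2 * int (card (B i)) = 2 * (int q)\<^sup>2 + ((\<Sum>y\<in>UNIV. ?f i y) + (\<Sum>y\<in>UNIV. ?h i y))"
    if "i < 4" for i
  proof -
    have "glue (?f i) (?h i) x = 1 \<or> glue (?f i) (?h i) x = - 1" for x
      using pm[OF that] unfolding glue_def by (cases "fst x = 0") simp_all
    from card_pm1[of "glue (?f i) (?h i)", OF finite_UNIV_bit_prod this] show ?thesis
      by (simp add: B_def sum_glue card_UNIV_bit_prod card_field)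
  qed
  \<comment> \<open>The two components of each of the first three blocks have opposite totals; only
    in the last do they add up to -2, which costs one element.\<close>
  have "int (card (B 0)) = int (q\<^sup>2)" "int (card (B 1)) = int (q\<^sup>2)" "int (card (B 2)) = int (q\<^sup>2)"
    "int (card (B 3)) = int (q\<^sup>2) - 1"
    using cardB[of 0] cardB[of 1] cardB[of 2] cardB[of 3] by (simp_all add: sum_fam)
  then have "card (B 0) = q\<^sup>2" "card (B 1) = q\<^sup>2" "card (B 2) = q\<^sup>2" "card (B 3) = q\<^sup>2 - 1"
    by linarith+
  ultimately show ?thesis by blast
qed

end

section \<open>From the form of \<open>q\<close> to the values of \<open>tau\<close>\<close>

theorem theorem1p2:
  fixes q :: nat and c :: int
  assumes "prime_power q"
    and "int q = 12 * c^2 + 4 * c + 3"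
    and "card (UNIV :: 'a::{finite, field} set) = q^2"
  shows "\<exists>B1 B2 B3 B4 :: (bit \<times> 'a) set.
           card B1 = q^2 \<and> card B2 = q^2 \<and> card B3 = q^2 \<and> card B4 = q^2 - 1 \<and>
           difference_family [B1, B2, B3, B4] (2 * q^2 - 2)"
proof -
  obtain p k where p: "prime p" "k \<ge> 1" "q = p ^ k"
    using assms(1) unfolding prime_power_def by blast
  have q8: "q mod 8 = 3"
  proof -
    have "even (c * (3 * c + 1))" by simp
    then obtain w where "c * (3 * c + 1) = 2 * w" by blast
    then have "int q = 8 * w + 3" using assms(2) by (simp add: power2_eq_square algebra_simps)
    then show ?thesis by presburger
  qed
  then have "odd q" by presburger
  then have "odd p" using p by (metis even_power not_one_le_zero neq0_conv)
  \<comment> \<open>An even exponent would make \<open>q\<close> an odd square, hence 1 modulo 8.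
    The same fact transfers the residue 3 from \<open>q\<close> to \<open>p\<close>.\<close>
  have "odd k"
  proof
    assume "even k"
    then have "q = (p ^ (k div 2))\<^sup>2" using p(3) by (simp flip: power_mult)
    then show False using q8 odd_square_mod_8[of "p ^ (k div 2)"] \<open>odd p\<close> by simp
  qed
  then obtain j where k: "k = 2 * j + 1" by (rule oddE)
  have p8: "p mod 8 = 3"
  proof -
    have "q = p * (p ^ j)\<^sup>2" unfolding p(3) k by (simp add: mult.commute flip: power_mult)
    moreover have "(p ^ j)\<^sup>2 mod 8 = 1" using odd_square_mod_8[of "p ^ j"] \<open>odd p\<close> by simp
    ultimately have "q mod 8 = p * 1 mod 8" by (metis mod_mult_right_eq)
    then show ?thesis using q8 by simp
  qed
  have char: "CHAR('a) = p"
  proof -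
    have pc: "prime CHAR('a)" by (rule prime_CHAR_semidom) (simp add: finite_imp_CHAR_pos)
    moreover have "CHAR('a) dvd (p ^ k)\<^sup>2" using CHAR_dvd_CARD[where 'a = 'a] assms(3) p(3) by simp
    ultimately show ?thesis using p(1) by (metis prime_dvd_power primes_dvd_imp_eq)
  qed
  obtain g :: 'a where g: "\<And>y. y \<noteq> 0 \<Longrightarrow> \<exists>i. y = g ^ i"
    using finite_field_generator by blast
  interpret quadratic_extension q g
  proof
    show "(x + y) ^ q = x ^ q + y ^ q" for x y :: 'a
      by (rule freshmans_dream'[of q k]) (use p char in auto)
  qed (use assms(3) q8 g in auto)
  have "\<not> int p dvd tau 0"
    by (rule not_char_dvd_tau_0[OF p(1) char[symmetric] p(3)[unfolded k] p8])
  \<comment> \<open>A second representation of \<open>q\<close> by the form of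
    \<open>tau_norm\<close>. Its entries differ by 2, which is what \<open>fam_cross\<close>
    needs.\<close>
  moreover have rep: "(2 * c - 1)\<^sup>2 + 2 * (2 * c + 1)\<^sup>2 = int (p ^ k)"
    using assms(2) p(3) by (simp add: power2_eq_square algebra_simps)
  moreover have "\<not> int p dvd 2 * c - 1"
  proof
    assume d: "int p dvd 2 * c - 1"
    have "int p dvd int q" using p by (simp add: dvd_power)
    \<comment> \<open>Division by \<open>2 * c - 1\<close> leaves remainder 8, so a common prime
      divisor would be 2.\<close>
    moreover have "int q = (2 * c - 1) * (6 * c + 5) + 8"
      using assms(2) by (simp add: power2_eq_square algebra_simps)
    ultimately have "int p dvd 8" using d by (metis dvd_add_right_iff dvd_mult2)
    then have "int p dvd 2 ^ 3" by simp
    then have "int p dvd 2" using p(1) prime_dvd_power by (metis prime_nat_int_transfer)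
    then have "p \<le> 2" using zdvd_imp_le by fastforce
    then show False using p8 by simp
  qed
  moreover have "p \<noteq> 2" using \<open>odd p\<close> by auto
  ultimately have "(tau 0)\<^sup>2 = (2 * c - 1)\<^sup>2 \<and> (tau 1)\<^sup>2 = (2 * c + 1)\<^sup>2"
    using square_plus_two_squares_unique[OF p(1) _ rep _ p(2)] tau_norm p(3) by simp
  then have "(tau 0 = 2 * c - 1 \<or> tau 0 = - (2 * c - 1)) \<and> (tau 1 = 2 * c + 1 \<or> tau 1 = - (2 * c + 1))"
    by (simp add: power2_eq_iff)
  \<comment> \<open>The sign \<open>s\<close> is chosen so that the terms with \<open>c\<close>
    cancel, leaving 2 or -2 to be squared.\<close>
  then have "(tau 0 + 1 * tau 1)\<^sup>2 = 4 \<or> (tau 0 + - 1 * tau 1)\<^sup>2 = 4" by auto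
  then show ?thesis using ex_difference_family[of 1] ex_difference_family[of "- 1"] by blast
qed

end
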